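(* Let $\gamma(n)$ be the Waldschmidt constant of the ideal of $n$ simple points in general position in $\mathbb{P}^3$ over a field of characteristic zero, and define $$\delta(n) = \frac{3\sqrt[3]{6n}+4.3}{7}.$$ If $n \geq 512$ is an integer, then $$\gamma(n) \geq \delta(n) \geq 0.7787 \sqrt[3]{n} + 0.6142.$$
   Context: Let $\mathbb{K}$ be a field of characteristic zero and $\mathbb{K}[x_0,\dots,x_3]$ the standard graded coordinate ring of $\mathbb{P}^3$. For a point $p$, $\mathfrak{m}_p$ is the homogeneous ideal generated by the forms vanishing at $p$. The ideal of simple points $p_1,\dots,p_n$ is $I=\bigcap_{j=1}^n \mathfrak{m}_{p_j}$, and its $m$-th symbolic power is $I^{(m)}=\bigcap_{j=1}^n \mathfrak{m}_{p_j}^{m}$. For a nonzero homogeneous ideal $J$, $\alpha(J)$ is the least $t\ge 0$ such that $J$ contains a nonzero form of degree $t$. The Waldschmidt constant is $\gamma(I)=\lim_{m\to\infty}\alpha(I^{(m)})/m$ (the limit exists), and $\gamma(n)=\gamma(I)$ for $I$ the ideal of $n$ simple points in general position in $\mathbb{P}^3$. Here, for each $m$, $\alpha(I^{(m)})$ for points in general position means the common value of $\alpha(\bigcap_{j}\mathfrak{m}_{p_j}^m)$ for all $(p_1,\dots,p_n)$ in a suitable nonempty Zariski-open subset of $(\mathbb{P}^3)^n$ (which may depend on $m$). *)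

theory Defs
  imports "HOL-Analysis.Analysis" "HOL-Library.Poly_Mapping" "HOL-Library.Numeral_Type"
begin

text \<open>
  Polynomials in variables indexed by \<open>'v\<close> are finitely supported functions from exponent
  vectors to coefficients. \<open>'v = 4\<close> gives \<open>K[x\<^sub>0,\<dots>,x\<^sub>3]\<close>; \<open>'v = nat \<times> 4\<close> gives the coordinate
  functions on tuples of points, the variable \<open>(j, i)\<close> being the \<open>i\<close>-th coordinate of the
  \<open>j\<close>-th point.
\<close>

type_synonym ('v, 'a) mpoly = "('v \<Rightarrow>\<^sub>0 nat) \<Rightarrow>\<^sub>0 'a"

definition eval_mpoly :: "('v \<Rightarrow> 'a::comm_semiring_1) \<Rightarrow> ('v, 'a) mpoly \<Rightarrow> 'a" where
  "eval_mpoly v f =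
    (\<Sum>u\<in>Poly_Mapping.keys f. Poly_Mapping.lookup f u *
      (\<Prod>i\<in>Poly_Mapping.keys u. v i ^ Poly_Mapping.lookup u i))"

definition is_form :: "nat \<Rightarrow> (4, 'a::zero) mpoly \<Rightarrow> bool" where
  "is_form t f \<longleftrightarrow> (\<forall>u\<in>Poly_Mapping.keys f. (\<Sum>i\<in>UNIV. Poly_Mapping.lookup u i) = t)"

text \<open>Ideals of a commutative ring are the submodules for the scalar action \<open>(*)\<close>.\<close>

definition ideal_gen :: "'r::comm_ring_1 set \<Rightarrow> 'r set" where
  "ideal_gen S = module.span (*) S"

definition ideal_power :: "'r::comm_ring_1 set \<Rightarrow> nat \<Rightarrow> 'r set" where
  "ideal_power I m = ideal_gen {(\<Prod>k<m. g k) | g. \<forall>k<m. g k \<in> I}"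

definition proj_rel :: "(('a::field ^ 4) \<times> ('a ^ 4)) set" where
  "proj_rel = {(v, w). v \<noteq> 0 \<and> w \<noteq> 0 \<and> (\<exists>c. w = c *s v)}"

text \<open>A point of \<open>\<P>\<^sup>3\<close> is the set of all its homogeneous coordinate vectors.\<close>

definition proj3 :: "('a::field ^ 4) set set" where
  "proj3 = (UNIV - {0}) // proj_rel"

definition point_ideal :: "('a::field ^ 4) set \<Rightarrow> (4, 'a) mpoly set" where
  "point_ideal p =
    ideal_gen {f. (\<exists>t. is_form t f) \<and> (\<forall>v\<in>p. eval_mpoly (($) v) f = 0)}"

definition symbolic_power :: "nat \<Rightarrow> (nat \<Rightarrow> ('a::field ^ 4) set) \<Rightarrow> nat \<Rightarrow> (4, 'a) mpoly set" where
  "symbolic_power n P m = (\<Inter>j<n. ideal_power (point_ideal (P j)) m)"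

definition initial_degree :: "(4, 'a::zero) mpoly set \<Rightarrow> nat" where
  "initial_degree J = (LEAST t. \<exists>f\<in>J. f \<noteq> 0 \<and> is_form t f)"

text \<open>
  Multihomogeneous polynomials on \<open>(\<P>\<^sup>3)\<^sup>n\<close>: of degree \<open>d j\<close> in the coordinates of the
  \<open>j\<close>-th point, for each \<open>j < n\<close>.
\<close>

definition multihomogeneous :: "nat \<Rightarrow> (nat \<Rightarrow> nat) \<Rightarrow> (nat \<times> 4, 'a::zero) mpoly \<Rightarrow> bool" where
  "multihomogeneous n d f \<longleftrightarrow>
    (\<forall>u\<in>Poly_Mapping.keys f. Poly_Mapping.keys u \<subseteq> {..<n} \<times> UNIV \<and>
      (\<forall>j<n. (\<Sum>i\<in>UNIV. Poly_Mapping.lookup u (j, i)) = d j))"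

text \<open>
  Zariski-open subsets of \<open>(\<P>\<^sup>3)\<^sup>n\<close>. Non-vanishing of a multihomogeneous polynomial does not
  depend on the choice of the representatives \<open>v j\<close>.
\<close>

definition zariski_open :: "nat \<Rightarrow> (nat \<Rightarrow> ('a::field ^ 4) set) set \<Rightarrow> bool" where
  "zariski_open n U \<longleftrightarrow>
    (\<exists>F. (\<forall>f\<in>F. \<exists>d. multihomogeneous n d f) \<and>
      U = {P \<in> {..<n} \<rightarrow>\<^sub>E proj3.
            \<exists>f\<in>F. \<exists>v. (\<forall>j<n. v j \<in> P j) \<and> eval_mpoly (\<lambda>(j, i). v j $ i) f \<noteq> 0})"

definition general_alpha :: "'a::field itself \<Rightarrow> nat \<Rightarrow> nat \<Rightarrow> nat" where
  "general_alpha _ n m =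
    (THE a. \<exists>U :: (nat \<Rightarrow> ('a ^ 4) set) set. zariski_open n U \<and> U \<noteq> {} \<and>
      (\<forall>P\<in>U. initial_degree (symbolic_power n P m) = a))"

definition waldschmidt :: "'a::field itself \<Rightarrow> nat \<Rightarrow> real" where
  "waldschmidt K n = lim (\<lambda>m. real (general_alpha K n m) / real m)"

definition delta :: "nat \<Rightarrow> real" where
  "delta n = (3 * root 3 (6 * real n) + 4.3) / 7"

end

theory Submission
  imports Defs "HOL-Computational_Algebra.Polynomial"
begin

text \<open>
  With \<open>k = \<lfloor>root 3 n\<rfloor>\<close>, the hypothesis \<open>n \<ge> 512\<close> gives \<open>\<delta>(n) \<le> k\<close>, so \<open>\<gamma>(n) \<ge> k\<close> is enough.
  By semicontinuity the general value of \<open>\<alpha>(I\<^sup>(\<^sup>m\<^sup>))\<close> is the largest one over all tuples of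
  points; this also makes it subadditive in \<open>m\<close>, so that Fekete's lemma gives the limit. It is
  at least its value for a tuple containing the grid of points \<open>(1 : a : b : c)\<close> with
  \<open>a, b, c < k\<close>, where a form of degree less than \<open>k m\<close> that vanishes to order \<open>m\<close> at all grid
  points is zero.
\<close>

text \<open>What links ideals to general position is a linear system. Whether a form lies in the
  m-th power of a point ideal is read off from its expansion at one coordinate vector. This gives
  linear equations on the coefficients whose entries are multihomogeneous in the points, so having
  only the zero solution is a Zariski-open condition. The open sets depend on \<open>m\<close>, and
  countably many of them need not have a common point over a countable field; comparing with the
  maximum over all tuples, for each \<open>m\<close> separately, avoids choosing one tuple for all
  orders. Passing to a grid is affordable because rounding x = root 3 n down loses less than 1,
  while \<open>delta\<close> has slope only about 0.78 in x. Characteristic zero enters twice: the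
  grid needs k distinct scalars, and two nonempty open sets meet because a line has infinitely many
  points.\<close>

abbreviation keys where "keys \<equiv> Poly_Mapping.keys"
abbreviation lookup where "lookup \<equiv> Poly_Mapping.lookup"
abbreviation single where "single \<equiv> Poly_Mapping.single"

subsection \<open>Substitution homomorphisms\<close>

definition monom_eval :: "('v \<Rightarrow> 'b::comm_semiring_1) \<Rightarrow> ('v \<Rightarrow>\<^sub>0 nat) \<Rightarrow> 'b" where
  "monom_eval x u = (\<Prod>i\<in>keys u. x i ^ lookup u i)"

text \<open>The coefficient map \<open>h\<close> is separate from the values of the variables, so
  that one operation covers evaluation (\<open>id\<close>), substitution of polynomials
  (\<open>Const\<close>) and expansion along a parameter (\<open>[:Const c:]\<close>).\<close>

definition subst :: "('a::zero \<Rightarrow> 'b::comm_semiring_1) \<Rightarrow> ('v \<Rightarrow> 'b) \<Rightarrow> ('v, 'a) mpoly \<Rightarrow> 'b" where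
  "subst h x f = (\<Sum>u\<in>keys f. h (lookup f u) * monom_eval x u)"

lemma eval_mpoly_eq_subst: "eval_mpoly v f = subst id v f"
  by (simp add: eval_mpoly_def subst_def monom_eval_def)

lemma monom_eval_superset:
  assumes "finite S" "keys u \<subseteq> S"
  shows "monom_eval x u = (\<Prod>i\<in>S. x i ^ lookup u i)"
  unfolding monom_eval_def
  by (rule prod.mono_neutral_left) (use assms in \<open>auto simp: in_keys_iff\<close>)

lemma monom_eval_UNIV: "monom_eval x (u :: 'v::finite \<Rightarrow>\<^sub>0 nat) = (\<Prod>i\<in>UNIV. x i ^ lookup u i)"
  by (rule monom_eval_superset) auto

lemma monom_eval_0 [simp]: "monom_eval x 0 = 1"
  by (simp add: monom_eval_def)

lemma monom_eval_add: "monom_eval x (u + w) = monom_eval x u * monom_eval x w"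
proof -
  let ?S = "keys u \<union> keys w"
  have "monom_eval x (u + w) = (\<Prod>i\<in>?S. x i ^ lookup (u + w) i)"
    by (rule monom_eval_superset) (simp_all add: keys_add)
  also have "\<dots> = (\<Prod>i\<in>?S. x i ^ lookup u i) * (\<Prod>i\<in>?S. x i ^ lookup w i)"
    by (simp add: lookup_add power_add prod.distrib)
  also have "\<dots> = monom_eval x u * monom_eval x w"
    by (simp add: monom_eval_superset[symmetric])
  finally show ?thesis .
qed

lemma monom_eval_single [simp]: "monom_eval x (single i (Suc 0)) = x i"
  by (simp add: monom_eval_def)

lemma poly_mapping_eq_sum_single:
  "f = (\<Sum>u\<in>keys f. single u (lookup f u))"
proof (rule poly_mapping_eqI)
  fix k
  have "lookup (\<Sum>u\<in>keys f. single u (lookup f u)) k = (\<Sum>u\<in>keys f. if u = k then lookup f u else 0)"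
    by (simp add: lookup_sum lookup_single when_def)
  also have "\<dots> = lookup f k"
    by (simp add: sum.delta in_keys_iff)
  finally show "lookup f k = lookup (\<Sum>u\<in>keys f. single u (lookup f u)) k" ..
qed

locale rhom =
  fixes h :: "'a::comm_ring_1 \<Rightarrow> 'b::comm_ring_1"
  assumes one: "h 1 = 1" and add: "h (a + b) = h a + h b" and mult: "h (a * b) = h a * h b"
begin

lemma zero [simp]: "h 0 = 0"
  using add[of 0 0] by simp

lemma uminus: "h (- a) = - h a"
  using add[of a "- a"] by (simp add: eq_neg_iff_add_eq_0 add.commute)

lemma diff: "h (a - b) = h a - h b"
  using add[of a "- b"] by (simp add: uminus)

lemma sum: "h (\<Sum>i\<in>A. g i) = (\<Sum>i\<in>A. h (g i))"
  by (induct A rule: infinite_finite_induct) (auto simp: add)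

lemma prod: "h (\<Prod>i\<in>A. g i) = (\<Prod>i\<in>A. h (g i))"
  by (induct A rule: infinite_finite_induct) (auto simp: mult one)

lemma power: "h (a ^ n) = h a ^ n"
  by (induct n) (auto simp: mult one)

lemma of_nat: "h (of_nat n) = of_nat n"
  by (induct n) (auto simp: add one)

lemma monom_eval: "h (monom_eval x u) = monom_eval (\<lambda>i. h (x i)) u"
  by (simp add: monom_eval_def prod power)

lemma subst_superset:
  assumes "finite S" "keys f \<subseteq> S"
  shows "subst h x f = (\<Sum>u\<in>S. h (lookup f u) * monom_eval x u)"
  unfolding subst_def
  by (rule sum.mono_neutral_left) (use assms in \<open>auto simp: in_keys_iff\<close>)

lemma subst_add: "subst h x (f + g) = subst h x f + subst h x g"
proof -
  let ?S = "keys f \<union> keys g"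
  have "subst h x (f + g) = (\<Sum>u\<in>?S. h (lookup (f + g) u) * monom_eval x u)"
    by (rule subst_superset) (simp_all add: keys_add)
  also have "\<dots> = (\<Sum>u\<in>?S. h (lookup f u) * monom_eval x u) + (\<Sum>u\<in>?S. h (lookup g u) * monom_eval x u)"
    by (simp add: lookup_add add distrib_right sum.distrib)
  also have "\<dots> = subst h x f + subst h x g"
    by (simp add: subst_superset[symmetric])
  finally show ?thesis .
qed

lemma subst_single: "subst h x (single u c) = h c * monom_eval x u"
  by (simp add: subst_def)

lemma subst_0 [simp]: "subst h x 0 = 0"
  by (simp add: subst_def)

lemma subst_sum: "subst h x (\<Sum>i\<in>A. g i) = (\<Sum>i\<in>A. subst h x (g i))"
  by (induct A rule: infinite_finite_induct) (auto simp: subst_add)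

lemma subst_mult: "subst h x (f * g) = subst h x f * subst h x g"
proof -
  have "f * g = (\<Sum>u\<in>keys f. \<Sum>w\<in>keys g. single (u + w) (lookup f u * lookup g w))"
    by (subst (1) poly_mapping_eq_sum_single[of f], subst (1) poly_mapping_eq_sum_single[of g])
      (simp add: sum_product mult_single)
  then have "subst h x (f * g) = (\<Sum>u\<in>keys f. \<Sum>w\<in>keys g. 
      (h (lookup f u) * monom_eval x u) * (h (lookup g w) * monom_eval x w))"
    by (simp add: subst_sum subst_single mult monom_eval_add algebra_simps)
  also have "\<dots> = subst h x f * subst h x g"
    by (simp add: subst_def sum_product)
  finally show ?thesis .
qed

lemma subst_1: "subst h x 1 = 1"
  using subst_single[of x 0 1] by (simp add: one)

lemma rhom_subst: "rhom (subst h x)"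
  by unfold_locales (simp_all add: subst_1 subst_add subst_mult)

end

lemma rhom_id: "rhom (id :: 'a::comm_ring_1 \<Rightarrow> 'a)"
  by unfold_locales auto

lemma rhom_compose: "rhom g \<Longrightarrow> rhom h \<Longrightarrow> rhom (\<lambda>x. g (h x))"
  by (simp add: rhom_def)

text \<open>A ring homomorphism on polynomials is determined by constants and variables. Later
  identities between evaluations, restrictions and expansions are reduced to the variables in this
  way.\<close>

lemma rhom_subst_comp:
  assumes "rhom g"
  shows "g (subst h x f) = subst (\<lambda>c. g (h c)) (\<lambda>i. g (x i)) f"
proof -
  interpret g: rhom g by fact
  show ?thesis by (simp add: subst_def g.sum g.mult g.monom_eval)
qed

section \<open>Constants, variables and the identity substitution\<close>

definition Const :: "'a::zero \<Rightarrow> ('v, 'a) mpoly" where "Const c = single 0 c"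
definition Var :: "'v \<Rightarrow> ('v, 'a::zero_neq_one) mpoly" where "Var i = single (single i 1) 1"

lemma rhom_Const: "rhom (Const :: 'a::comm_ring_1 \<Rightarrow> ('v, 'a) mpoly)"
  by unfold_locales (simp_all add: Const_def single_add mult_single)

lemma subst_Const: "rhom h \<Longrightarrow> subst h x (Const c) = h c"
  by (simp add: Const_def rhom.subst_single)

lemma subst_Var: "rhom h \<Longrightarrow> subst h x (Var i) = x i"
  by (simp add: Var_def rhom.subst_single rhom.one)

lemma monom_eval_Var: "monom_eval Var u = (single u 1 :: ('v, 'a::comm_ring_1) mpoly)"
proof -
  have pow: "Var i ^ n = (single (single i n) 1 :: ('v, 'a) mpoly)" for i n
    by (induct n) (auto simp: Var_def mult_single single_add[symmetric])
  have "(\<Prod>i\<in>A. single (w i) 1) = (single (\<Sum>i\<in>A. w i) 1 :: ('v, 'a) mpoly)" for w :: "'v \<Rightarrow> 'v \<Rightarrow>\<^sub>0 nat" and A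
    by (induct A rule: infinite_finite_induct) (auto simp: mult_single)
  then show ?thesis
    by (simp add: monom_eval_def pow poly_mapping_eq_sum_single[symmetric])
qed

lemma subst_Const_Var: "subst Const Var f = (f :: ('v, 'a::comm_ring_1) mpoly)"
proof -
  have "subst Const Var f = (\<Sum>u\<in>keys f. single u (lookup f u))"
    by (simp add: subst_def monom_eval_Var Const_def mult_single)
  then show ?thesis by (simp add: poly_mapping_eq_sum_single[symmetric])
qed

subsection \<open>Forms\<close>

definition mdeg :: "(4 \<Rightarrow>\<^sub>0 nat) \<Rightarrow> nat" where
  "mdeg u = (\<Sum>i\<in>UNIV. lookup u i)"

lemma mdeg_add: "mdeg (u + w) = mdeg u + mdeg w"
  by (simp add: mdeg_def lookup_add sum.distrib)

lemma mdeg_single [simp]: "mdeg (single i n) = n"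
  by (simp add: mdeg_def lookup_single when_def sum.delta)

lemma mdeg_0 [simp]: "mdeg 0 = 0"
  by (simp add: mdeg_def)

lemma lookup_le_mdeg: "lookup u i \<le> mdeg u"
  unfolding mdeg_def by (rule member_le_sum) auto

lemma is_form_alt: "is_form t f \<longleftrightarrow> (\<forall>u\<in>keys f. mdeg u = t)"
  by (simp add: is_form_def mdeg_def)

lemma is_form_0 [simp]: "is_form t 0"
  by (simp add: is_form_alt)

lemma is_form_single: "mdeg u = t \<Longrightarrow> is_form t (single u c)"
  by (simp add: is_form_alt)

lemma is_form_Const: "is_form 0 (Const c)"
  by (simp add: Const_def is_form_single)

lemma is_form_Var: "is_form 1 (Var i)"
  by (simp add: Var_def is_form_single)

lemma is_form_1: "is_form 0 (1 :: (4, 'a::comm_ring_1) mpoly)"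
  by (simp add: is_form_alt)

lemma is_form_add: "is_form t f \<Longrightarrow> is_form t g \<Longrightarrow> is_form t (f + g)"
  using keys_add[of f g] by (auto simp: is_form_alt)

lemma is_form_diff: "is_form t (f :: (4, 'a::comm_ring_1) mpoly) \<Longrightarrow> is_form t g \<Longrightarrow> is_form t (f - g)"
  using keys_diff[of f g] by (auto simp: is_form_alt)

lemma is_form_sum: "(\<And>i. i \<in> A \<Longrightarrow> is_form t (g i)) \<Longrightarrow> is_form t (\<Sum>i\<in>A. g i)"
  by (induct A rule: infinite_finite_induct) (auto intro: is_form_add)

lemma is_form_mult: "is_form s f \<Longrightarrow> is_form t g \<Longrightarrow> is_form (s + t) (f * g)"
  for f g :: "(4, 'a::comm_ring_1) mpoly"
  using keys_mult[of f g] by (fastforce simp: is_form_alt mdeg_add)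

lemma is_form_prod: "(\<And>i. i \<in> A \<Longrightarrow> is_form (d i) (g i)) \<Longrightarrow> is_form (\<Sum>i\<in>A. d i) (\<Prod>i\<in>A. g i)"
  for g :: "'i \<Rightarrow> (4, 'a::comm_ring_1) mpoly"
  by (induct A rule: infinite_finite_induct) (auto intro: is_form_mult is_form_1)

lemma is_form_power: "is_form s f \<Longrightarrow> is_form (n * s) (f ^ n)"
  for f :: "(4, 'a::comm_ring_1) mpoly"
  by (induct n) (auto intro: is_form_mult is_form_1)

lemma finite_mdeg: "finite {u. mdeg u = t}"
proof -
  have "inj_on lookup {u. mdeg u = t}"
    by (auto simp: inj_on_def intro: poly_mapping_eqI)
  moreover have "lookup ` {u. mdeg u = t} \<subseteq> PiE UNIV (\<lambda>_. {..t})"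
    using lookup_le_mdeg by auto
  ultimately show ?thesis
    by (meson finite_PiE finite_atMost finite_imageD finite_subset finite)
qed

text \<open>Coefficient of \<open>y\<^sup>b\<close> in \<open>f (a + y)\<close>, that is, the Hasse derivative of \<open>f\<close> at \<open>a\<close>.\<close>

definition hasse_monom :: "(4 \<Rightarrow> nat) \<Rightarrow> (4 \<Rightarrow>\<^sub>0 nat) \<Rightarrow> (4 \<Rightarrow> 'a) \<Rightarrow> 'a::comm_ring_1" where
  "hasse_monom b u a = (\<Prod>i\<in>UNIV. of_nat (lookup u i choose b i) * a i ^ (lookup u i - b i))"

definition hasse :: "(4 \<Rightarrow> nat) \<Rightarrow> (4, 'a) mpoly \<Rightarrow> (4 \<Rightarrow> 'a) \<Rightarrow> 'a::comm_ring_1" where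
  "hasse b f a = (\<Sum>u\<in>keys f. lookup f u * hasse_monom b u a)"

text \<open>Makes the truncated exponent \<open>lookup u i - b i\<close> harmless: the binomial
  coefficient is zero whenever truncation occurs.\<close>

lemma hasse_monom_eq_0: "lookup u i < b i \<Longrightarrow> hasse_monom b u a = 0"
  unfolding hasse_monom_def by (rule prod_zero) (auto intro!: exI[of _ i] simp: binomial_eq_0)

text \<open>The base point is scaled by \<open>r\<close>. Since \<open>u\<close> has degree
  \<open>t\<close>, the power of \<open>r\<close> depends on \<open>b\<close> alone, so the
  monomials of a form can be added up. Used with r = 1 to expand at a vector, and with
  \<open>r\<close> a multiple of a coordinate to stay among homogeneous polynomials.\<close>

lemma taylor_monom:
  assumes h: "rhom h" and u: "mdeg u = t"
  shows "monom_eval (\<lambda>i. r * h (a i) + y i) u =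
    (\<Sum>b\<in>PiE UNIV (\<lambda>_. {..t}). h (hasse_monom b u a) * r ^ (t - (\<Sum>i\<in>UNIV. b i)) * (\<Prod>i\<in>UNIV. y i ^ b i))"
proof -
  interpret rhom h by fact
  have le: "lookup u i \<le> t" for i using lookup_le_mdeg u by metis
  have bin: "(r * h (a i) + y i) ^ lookup u i = (\<Sum>k\<le>t.
      of_nat (lookup u i choose k) * (r * h (a i)) ^ (lookup u i - k) * y i ^ k)" for i
  proof -
    have "(r * h (a i) + y i) ^ lookup u i = (\<Sum>k\<le>lookup u i.
      of_nat (lookup u i choose k) * (r * h (a i)) ^ (lookup u i - k) * y i ^ k)"
      by (subst add.commute, subst binomial_ring) (simp add: ac_simps)
    also have "\<dots> = (\<Sum>k\<le>t.
      of_nat (lookup u i choose k) * (r * h (a i)) ^ (lookup u i - k) * y i ^ k)"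
      by (rule sum.mono_neutral_left) (use le[of i] in \<open>auto simp: binomial_eq_0\<close>)
    finally show ?thesis .
  qed
  have "monom_eval (\<lambda>i. r * h (a i) + y i) u = (\<Prod>i\<in>UNIV. \<Sum>k\<le>t.
      of_nat (lookup u i choose k) * (r * h (a i)) ^ (lookup u i - k) * y i ^ k)"
    by (simp add: monom_eval_UNIV bin)
  also have "\<dots> = (\<Sum>b\<in>PiE UNIV (\<lambda>_. {..t}). \<Prod>i\<in>UNIV.
      of_nat (lookup u i choose b i) * (r * h (a i)) ^ (lookup u i - b i) * y i ^ b i)"
    by (rule prod_sum_PiE) auto
  also have "\<dots> = (\<Sum>b\<in>PiE UNIV (\<lambda>_. {..t}). h (hasse_monom b u a) * r ^ (t - (\<Sum>i\<in>UNIV. b i)) *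
    (\<Prod>i\<in>UNIV. y i ^ b i))"
  proof (rule sum.cong[OF refl])
    fix b :: "4 \<Rightarrow> nat" assume "b \<in> PiE UNIV (\<lambda>_. {..t})"
    have "(\<Prod>i\<in>UNIV. of_nat (lookup u i choose b i) * (r * h (a i)) ^ (lookup u i - b i) * y i ^ b i)
      = (\<Prod>i\<in>UNIV. of_nat (lookup u i choose b i) * h (a i) ^ (lookup u i - b i)) *
        (\<Prod>i\<in>UNIV. r ^ (lookup u i - b i)) * (\<Prod>i\<in>UNIV. y i ^ b i)"
      by (simp add: power_mult_distrib prod.distrib algebra_simps)
    also have "\<dots> = h (hasse_monom b u a) * (\<Prod>i\<in>UNIV. r ^ (lookup u i - b i)) * (\<Prod>i\<in>UNIV. y i ^ b i)"
      by (simp add: hasse_monom_def prod mult of_nat power)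
    \<comment> \<open>If some \<open>b i\<close> exceeds the exponent, the two powers of
      \<open>r\<close> may differ, but then the Hasse coefficient is zero.\<close>
    also have "\<dots> = h (hasse_monom b u a) * r ^ (t - (\<Sum>i\<in>UNIV. b i)) * (\<Prod>i\<in>UNIV. y i ^ b i)"
    proof (cases "\<forall>i. b i \<le> lookup u i")
      case True
      then have "(\<Sum>i\<in>UNIV. lookup u i - b i) = t - (\<Sum>i\<in>UNIV. b i)"
        using u by (simp add: sum_subtractf_nat mdeg_def)
      then show ?thesis by (simp add: power_sum[symmetric])
    next
      case False
      then have "hasse_monom b u a = 0" by (meson hasse_monom_eq_0 not_le)
      then show ?thesis by simp
    qed
    finally show "(\<Prod>i\<in>UNIV. of_nat (lookup u i choose b i) * (r * h (a i)) ^ (lookup u i - b i) * y i ^ b i)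
      = h (hasse_monom b u a) * r ^ (t - (\<Sum>i\<in>UNIV. b i)) * (\<Prod>i\<in>UNIV. y i ^ b i)" .
  qed
  finally show ?thesis .
qed

lemma taylor_form:
  assumes h: "rhom h" and f: "is_form t f"
  shows "subst h (\<lambda>i. r * h (a i) + y i) f =
    (\<Sum>b\<in>PiE UNIV (\<lambda>_. {..t}). h (hasse b f a) * r ^ (t - (\<Sum>i\<in>UNIV. b i)) * (\<Prod>i\<in>UNIV. y i ^ b i))"
proof -
  interpret rhom h by fact
  have "subst h (\<lambda>i. r * h (a i) + y i) f = (\<Sum>u\<in>keys f. \<Sum>b\<in>PiE UNIV (\<lambda>_. {..t}).
     h (lookup f u * hasse_monom b u a) * r ^ (t - (\<Sum>i\<in>UNIV. b i)) * (\<Prod>i\<in>UNIV. y i ^ b i))"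
    unfolding subst_def
    by (rule sum.cong)
      (use f in \<open>auto simp: is_form_alt taylor_monom[OF h] sum_distrib_left mult mult.assoc\<close>)
  also have "\<dots> = (\<Sum>b\<in>PiE UNIV (\<lambda>_. {..t}). \<Sum>u\<in>keys f. 
     h (lookup f u * hasse_monom b u a) * r ^ (t - (\<Sum>i\<in>UNIV. b i)) * (\<Prod>i\<in>UNIV. y i ^ b i))"
    by (rule sum.swap)
  also have "\<dots> = (\<Sum>b\<in>PiE UNIV (\<lambda>_. {..t}). h (hasse b f a) * r ^ (t - (\<Sum>i\<in>UNIV. b i)) * (\<Prod>i\<in>UNIV. y i ^ b i))"
    by (simp add: hasse_def sum sum_distrib_right)
  finally show ?thesis .
qed

subsection \<open>Ideals and their powers\<close>

lemma module_times: "module ((*) :: 'r::comm_ring_1 \<Rightarrow> 'r \<Rightarrow> 'r)"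
  by unfold_locales (simp_all add: algebra_simps)

lemma ideal_gen_base: "x \<in> S \<Longrightarrow> x \<in> ideal_gen S"
  unfolding ideal_gen_def by (rule module.span_base[OF module_times])

lemma ideal_gen_mult: "x \<in> ideal_gen S \<Longrightarrow> r * x \<in> ideal_gen S"
  unfolding ideal_gen_def by (rule module.span_scale[OF module_times])

lemma ideal_gen_sum: "(\<And>i. i \<in> A \<Longrightarrow> g i \<in> ideal_gen S) \<Longrightarrow> (\<Sum>i\<in>A. g i) \<in> ideal_gen S"
  unfolding ideal_gen_def by (rule module.span_sum[OF module_times])

lemma ideal_gen_induct [consumes 1, case_names zero step]:
  assumes "x \<in> ideal_gen S" "P 0" "\<And>r s y. s \<in> S \<Longrightarrow> P y \<Longrightarrow> P (r * s + y)"
  shows "P x"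
  by (rule module.span_induct_alt[OF module_times assms(1)[unfolded ideal_gen_def]]) (fact assms)+

lemma ideal_power_mult: "x \<in> ideal_power I m \<Longrightarrow> r * x \<in> ideal_power I m"
  unfolding ideal_power_def by (rule ideal_gen_mult)

lemma ideal_power_sum: "(\<And>i. i \<in> A \<Longrightarrow> g i \<in> ideal_power I m) \<Longrightarrow> (\<Sum>i\<in>A. g i) \<in> ideal_power I m"
  unfolding ideal_power_def by (rule ideal_gen_sum)

lemma ideal_power_plus: "x \<in> ideal_power I m \<Longrightarrow> y \<in> ideal_power I m \<Longrightarrow> x + y \<in> ideal_power I m"
  unfolding ideal_power_def ideal_gen_def by (rule module.span_add[OF module_times])

lemma zero_mem_ideal_power: "0 \<in> ideal_power I m"
  unfolding ideal_power_def ideal_gen_def by (rule module.span_zero[OF module_times])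

lemma ideal_power_0 [simp]: "x \<in> ideal_power I 0"
proof -
  have "1 \<in> ideal_power I 0" unfolding ideal_power_def by (rule ideal_gen_base) auto
  from ideal_power_mult[OF this, of x] show ?thesis by simp
qed

lemma prod_mem_ideal_power: "(\<And>k. k < m \<Longrightarrow> g k \<in> I) \<Longrightarrow> (\<Prod>k<m. g k) \<in> ideal_power I m"
  unfolding ideal_power_def by (rule ideal_gen_base) auto

lemma prod_lessThan_append:
  fixes f g :: "nat \<Rightarrow> 'r::comm_ring_1"
  shows "(\<Prod>k<a. f k) * (\<Prod>k<b. g k) = (\<Prod>k<a + b. if k < a then f k else g (k - a))"
proof (induct b)
  case (Suc b)
  have "(\<Prod>k<a. f k) * (\<Prod>k<Suc b. g k) = ((\<Prod>k<a. f k) * (\<Prod>k<b. g k)) * g b"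
    by (simp add: mult.assoc)
  then show ?case by (simp add: Suc)
qed simp

lemma ideal_power_add:
  assumes "x \<in> ideal_power I a" "y \<in> ideal_power I b"
  shows "x * y \<in> ideal_power I (a + b)"
proof -
  have 1: "(\<Prod>k<a. f k) * y \<in> ideal_power I (a + b)" if f: "\<forall>k<a. f k \<in> I" for f
    using assms(2) unfolding ideal_power_def[of I b]
  proof (induction rule: ideal_gen_induct)
    case zero
    show ?case by (simp add: zero_mem_ideal_power)
  next
    case (step r s y)
    then obtain g where g: "s = (\<Prod>k<b. g k)" "\<forall>k<b. g k \<in> I" by auto
    have "(\<Prod>k<a. f k) * s \<in> ideal_power I (a + b)"
      unfolding g(1) prod_lessThan_append by (rule prod_mem_ideal_power) (use f g in auto)
    from ideal_power_plus[OF ideal_power_mult[OF this, of r] step.IH]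
    show ?case by (simp add: algebra_simps)
  qed
  show ?thesis
    using assms(1) unfolding ideal_power_def[of I a]
  proof (induction rule: ideal_gen_induct)
    case zero
    show ?case by (simp add: zero_mem_ideal_power)
  next
    case (step r s x)
    then obtain f where f: "s = (\<Prod>k<a. f k)" "\<forall>k<a. f k \<in> I" by auto
    from ideal_power_plus[OF ideal_power_mult[OF 1[OF f(2)], of r] step.IH]
    show ?case by (simp add: f(1) algebra_simps)
  qed
qed

text \<open>Surplus factors of a generator are absorbed into its ring coefficient, one at a
  time.\<close>

lemma ideal_power_mono: "x \<in> ideal_power I a \<Longrightarrow> b \<le> a \<Longrightarrow> x \<in> ideal_power I b"
  for I :: "'r::comm_ring_1 set"
proof (induction "a - b" arbitrary: a x)
  case (Suc d)
  then obtain a' where a': "a = Suc a'" "b \<le> a'" "d = a' - b" by (cases a) auto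
  have "x \<in> ideal_power I a'" using Suc.prems(1) unfolding ideal_power_def[of I a]
  proof (induction rule: ideal_gen_induct)
    case zero
    show ?case by (simp add: zero_mem_ideal_power)
  next
    case (step r s x)
    then obtain f where f: "s = (\<Prod>k<a. f k)" "\<forall>k<a. f k \<in> I" by auto
    have "(r * f a') * (\<Prod>k<a'. f k) \<in> ideal_power I a'"
      by (intro ideal_power_mult prod_mem_ideal_power) (use f a' in auto)
    moreover have "(r * f a') * (\<Prod>k<a'. f k) = r * s"
      by (simp add: f(1) a'(1) mult.commute mult.left_commute)
    ultimately show ?case using step.IH by (simp add: ideal_power_plus)
  qed
  then show ?case using a' Suc.hyps(1) by blast
next
  case 0
  then have "a = b" by simp
  with 0 show ?case by simp
qed

lemma ideal_power_power: "x \<in> I \<Longrightarrow> x ^ m \<in> ideal_power I m"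
  using prod_mem_ideal_power[of m "\<lambda>_. x" I] by simp

lemma ideal_power_prod:
  assumes "\<And>i. i \<in> A \<Longrightarrow> g i \<in> I"
  shows "(\<Prod>i\<in>A. g i ^ b i) \<in> ideal_power I (\<Sum>i\<in>A. b i)"
  using assms
proof (induct A rule: infinite_finite_induct)
  case (insert x A)
  then have "g x ^ b x * (\<Prod>i\<in>A. g i ^ b i) \<in> ideal_power I (b x + (\<Sum>i\<in>A. b i))"
    by (intro ideal_power_add ideal_power_power) auto
  with insert show ?case by simp
qed simp_all

subsection \<open>Order of vanishing at a point\<close>

text \<open>\<open>f (v + s x)\<close> as a polynomial in \<open>s\<close> with coefficients in \<open>K[x]\<close>.\<close>

definition expand :: "(4 \<Rightarrow> 'a) \<Rightarrow> (4, 'a::comm_ring_1) mpoly \<Rightarrow> (4, 'a) mpoly poly" where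
  "expand v = subst (\<lambda>c. [:Const c:]) (\<lambda>i. [:Const (v i), Var i:])"

text \<open>The direction \<open>x\<close> is generic, so the power of \<open>s\<close> dividing f(v
  + s x) is the order of vanishing at \<open>v\<close>. Stated as divisibility, it passes to sums
  and products at once.\<close>

definition vanish :: "nat \<Rightarrow> (4 \<Rightarrow> 'a) \<Rightarrow> (4, 'a::comm_ring_1) mpoly \<Rightarrow> bool" where
  "vanish m v f \<longleftrightarrow> monom 1 m dvd expand v f"

lemma vanish_iff_coeff: "vanish m v f \<longleftrightarrow> (\<forall>k<m. coeff (expand v f) k = 0)"
  by (simp add: vanish_def monom_1_dvd_iff')

lemma rhom_pCons_0: "rhom (\<lambda>c. [:c:] :: 'b::comm_ring_1 poly)"
  by unfold_locales auto

lemma rhom_pCons_Const: "rhom (\<lambda>c. [:Const c:] :: ('v, 'a::comm_ring_1) mpoly poly)"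
  by (rule rhom_compose[OF rhom_pCons_0 rhom_Const])

lemma rhom_expand: "rhom (expand v)"
  unfolding expand_def by (rule rhom.rhom_subst[OF rhom_pCons_Const])

lemma rhom_poly: "rhom (\<lambda>p. poly p x)" for x :: "'b::comm_ring_1"
  by unfold_locales auto

lemma coeff_0_expand: "coeff (expand v f) 0 = Const (eval_mpoly v f)"
proof -
  have "coeff (expand v f) 0 = subst Const (\<lambda>i. Const (v i)) f"
    by (simp add: poly_0_coeff_0[symmetric] expand_def rhom_subst_comp[OF rhom_poly])
  also have "\<dots> = Const (subst id v f)"
    by (simp add: rhom_subst_comp[OF rhom_Const])
  finally show ?thesis by (simp add: eval_mpoly_eq_subst)
qed

lemma vanish_zero [simp]: "vanish m v 0"
  by (simp add: vanish_def rhom.zero[OF rhom_expand])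

lemma vanish_1_iff: "vanish (Suc 0) v f \<longleftrightarrow> eval_mpoly v f = 0"
  by (simp add: vanish_iff_coeff coeff_0_expand Const_def del: coeff_0) (metis lookup_single_eq
    lookup_zero single_zero)

lemma vanish_add: "vanish m v f \<Longrightarrow> vanish m v g \<Longrightarrow> vanish m v (f + g)"
  by (simp add: vanish_def rhom.add[OF rhom_expand])

lemma vanish_mult: "vanish m v f \<Longrightarrow> vanish m v (g * f)"
  by (simp add: vanish_def rhom.mult[OF rhom_expand])

lemma vanish_prod: 
  assumes "\<And>k. k < m \<Longrightarrow> vanish (Suc 0) v (g k)"
  shows "vanish m v (\<Prod>k<m. g k)"
proof -
  have "(\<Prod>k<m. monom 1 (Suc 0)) dvd (\<Prod>k<m. expand v (g k))"
    by (rule prod_dvd_prod) (use assms in \<open>auto simp: vanish_def\<close>)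
  then show ?thesis by (simp add: vanish_def rhom.prod[OF rhom_expand] monom_power)
qed

lemma vanish_ideal_gen:
  assumes "f \<in> ideal_gen S" "\<And>s. s \<in> S \<Longrightarrow> vanish m v s"
  shows "vanish m v f"
  using assms(1) by (induction rule: ideal_gen_induct) (auto intro: vanish_add vanish_mult assms(2))

text \<open>The coefficient of s^k is the sum of \<open>hasse b f v\<close> times x^b over all b of
  total degree k. Distinct \<open>b\<close> give distinct monomials, so nothing cancels.\<close>

lemma vanish_iff_hasse:
  assumes f: "is_form t f"
  shows "vanish m v f \<longleftrightarrow>
    (\<forall>b\<in>PiE UNIV (\<lambda>_. {..t}). (\<Sum>i\<in>UNIV. b i) < m \<longrightarrow> hasse b f v = 0)"
proof -
  let ?B = "PiE (UNIV :: 4 set) (\<lambda>_. {..t})"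
  define pm :: "(4 \<Rightarrow> nat) \<Rightarrow> (4 \<Rightarrow>\<^sub>0 nat)" where "pm = Abs_poly_mapping"
  have pm [simp]: "lookup (pm b) = b" for b
    by (simp add: pm_def Abs_poly_mapping_inverse)
  have pm_inj: "pm b = pm b' \<longleftrightarrow> b = b'" for b b' by (metis pm)
  have prod: "(\<Prod>i\<in>UNIV. [:0, Var i:] ^ b i) = monom (single (pm b) (1::'a)) (\<Sum>i\<in>UNIV. b i)" for b
  proof -
    have A: "(\<Prod>i\<in>A. [:0, Var i :: (4, 'a) mpoly:] ^ b i) = monom (\<Prod>i\<in>A. Var i ^ b i) (\<Sum>i\<in>A. b i)" for A
    proof (induct A rule: infinite_finite_induct)
      case (insert x A)
      have "[:0, Var x :: (4, 'a) mpoly:] = monom (Var x) 1" by (simp add: monom_altdef)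
      with insert show ?case by (simp add: monom_power mult_monom)
    qed auto
    have "(\<Prod>i\<in>UNIV. Var i ^ b i) = monom_eval (Var :: 4 \<Rightarrow> (4, 'a) mpoly) (pm b)"
      by (simp add: monom_eval_UNIV)
    then show ?thesis by (simp add: A monom_eval_Var)
  qed
  have fin: "finite ?B" by (intro finite_PiE) auto
  \<comment> \<open>Brings the argument into the shape of the Taylor expansion with r = 1.\<close>
  have arg: "(\<lambda>i. [:Const (v i), Var i:]) = (\<lambda>i. 1 * [:Const (v i):] + [:0, Var i:])" by auto
  have "expand v f = (\<Sum>b\<in>?B. [:Const (hasse b f v):] * 1 ^ (t - (\<Sum>i\<in>UNIV. b i)) *
    (\<Prod>i\<in>UNIV. [:0, Var i:] ^ b i))"
    unfolding expand_def arg by (rule taylor_form[OF rhom_pCons_Const f])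
  also have "\<dots> = (\<Sum>b\<in>?B. monom (single (pm b) (hasse b f v)) (\<Sum>i\<in>UNIV. b i))"
    by (rule sum.cong) (simp_all add: prod smult_monom Const_def mult_single)
  finally have ex: "expand v f = (\<Sum>b\<in>?B. monom (single (pm b) (hasse b f v)) (\<Sum>i\<in>UNIV. b i))" .
  have co: "coeff (expand v f) k = (\<Sum>b\<in>?B. if (\<Sum>i\<in>UNIV. b i) = k then single (pm b) (hasse b f v) else
    0)" for k
    by (simp add: ex coeff_sum)
  have lk: "lookup (coeff (expand v f) (\<Sum>i\<in>UNIV. b i)) (pm b) = hasse b f v" if "b \<in> ?B" for b
  proof -
    have "lookup (coeff (expand v f) (\<Sum>i\<in>UNIV. b i)) (pm b) = (\<Sum>b'\<in>?B. if b' = b then hasse b f v else 0)"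
      unfolding co lookup_sum
      by (rule sum.cong) (auto simp: lookup_single when_def pm_inj)
    then show ?thesis using that fin by (simp add: sum.delta)
  qed
  show ?thesis unfolding vanish_iff_coeff
  proof (intro iffI ballI allI impI)
    fix b assume "\<forall>k<m. coeff (expand v f) k = 0" "b \<in> ?B" "(\<Sum>i\<in>UNIV. b i) < m"
    then show "hasse b f v = 0" using lk[of b] by simp
  next
    fix k assume *: "\<forall>b\<in>?B. (\<Sum>i\<in>UNIV. b i) < m \<longrightarrow> hasse b f v = 0" "k < m"
    show "coeff (expand v f) k = 0" unfolding co by (rule sum.neutral) (use * in auto)
  qed
qed

subsection \<open>Fat points\<close>

lemma proj3_nonzero: "p \<in> proj3 \<Longrightarrow> v \<in> p \<Longrightarrow> v \<noteq> 0"
  by (auto simp: proj3_def proj_rel_def quotient_def)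

lemma proj3_scale:
  assumes "p \<in> proj3" "v \<in> p" "w \<in> p"
  shows "\<exists>c. w = c *s v"
proof -
  from assms(1) obtain x where x: "p = proj_rel `` {x}" by (auto simp: proj3_def quotient_def)
  from assms(2) x obtain c where "v = c *s x" "v \<noteq> 0" by (auto simp: proj_rel_def)
  moreover from assms(3) x obtain d where "w = d *s x" by (auto simp: proj_rel_def)
  moreover from calculation have "c \<noteq> 0" by auto
  ultimately have "w = (d / c) *s v" by (simp add: vector_smult_assoc)
  then show ?thesis ..
qed

lemma proj3_nonempty: "p \<in> proj3 \<Longrightarrow> \<exists>v. v \<in> p"
proof -
  assume "p \<in> proj3"
  then obtain x where "x \<noteq> 0" "p = proj_rel `` {x}" by (auto simp: proj3_def quotient_def)
  then have "x \<in> p" by (auto simp: proj_rel_def intro: exI[of _ 1])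
  then show ?thesis ..
qed

lemma ex_proj3: "v \<noteq> 0 \<Longrightarrow> \<exists>p\<in>proj3. v \<in> p"
  by (rule bexI[of _ "proj_rel `` {v}"]) (auto simp: proj_rel_def proj3_def quotient_def intro: exI[of _ 1])

lemma vanish_point_power:
  assumes "f \<in> ideal_power (point_ideal p) m" "v \<in> p"
  shows "vanish m (($) v) f"
proof -
  have "vanish (Suc 0) (($) v) g" if "g \<in> point_ideal p" for g
    using that unfolding point_ideal_def
    by (rule vanish_ideal_gen) (use assms(2) in \<open>auto simp: vanish_1_iff\<close>)
  then have "vanish m (($) v) (\<Prod>k<m. g k)" if "\<forall>k<m. g k \<in> point_ideal p" for g
    using that by (intro vanish_prod) auto
  then show ?thesis
    by (intro vanish_ideal_gen[OF assms(1)[unfolded ideal_power_def]]) auto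
qed

lemma subst_diff: "rhom h \<Longrightarrow> subst h x (f - g) = subst h x f - subst h x g"
  by (rule rhom.diff[OF rhom.rhom_subst])

lemma subst_times: "rhom h \<Longrightarrow> subst h x (f * g) = subst h x f * subst h x g"
  by (rule rhom.subst_mult)

text \<open>The coordinate vectors of a point are multiples of each other, so one representative
  decides whether a linear form vanishes there.\<close>

lemma linear_mem_point_ideal:
  assumes p: "p \<in> proj3" "v \<in> p" and l: "eval_mpoly (($) v) l = 0" 
    and l_def: "l = Const a * Var i - Const b * Var j"
  shows "l \<in> point_ideal p"
  unfolding point_ideal_def
proof (rule ideal_gen_base, intro CollectI conjI ballI)
  show "\<exists>t. is_form t l" unfolding l_def
    using is_form_diff is_form_mult[OF is_form_Const is_form_Var] by blast
  have ev: "eval_mpoly x l = a * x i - b * x j" for x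
    by (simp add: l_def eval_mpoly_eq_subst subst_diff[OF rhom_id] subst_times[OF rhom_id]
      subst_Var[OF rhom_id] subst_Const[OF rhom_id])
  fix w assume "w \<in> p"
  then obtain c where "w = c *s v" using proj3_scale p by blast
  then show "eval_mpoly (($) w) l = 0"
    using l unfolding ev by (simp add: algebra_simps)
qed

text \<open>With v_k nonzero, write x_i = r v_i + l_i, where r = x_k / v_k and l_i vanishes at the
  point. In the Taylor expansion of \<open>f\<close> in the l_i, the coefficients of total order
  below \<open>m\<close> are zero, and every other term has at least \<open>m\<close> factors in the
  point ideal. Homogeneity of \<open>f\<close> is what allows the linear form \<open>r\<close> in
  place of a constant.\<close>

lemma form_mem_point_power:
  fixes f :: "(4, 'a::field) mpoly"
  assumes p: "p \<in> proj3" "v \<in> p" and f: "is_form t f" and m: "vanish m (($) v) f"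
  shows "f \<in> ideal_power (point_ideal p) m"
proof -
  obtain k where k: "v $ k \<noteq> 0" using proj3_nonzero[OF p] by (auto simp: vec_eq_iff)
  define l :: "4 \<Rightarrow> (4, 'a) mpoly" where "l = (\<lambda>i. Const 1 * Var i - Const (v $ i / v $ k) * Var k)"
  define r :: "(4, 'a) mpoly" where "r = Const (1 / v $ k) * Var k"
  have l: "l i \<in> point_ideal p" for i
    by (rule linear_mem_point_ideal[OF p _ l_def[THEN fun_cong]])
      (use k in \<open>simp add: l_def eval_mpoly_eq_subst subst_diff[OF rhom_id] subst_times[OF rhom_id]
        subst_Var[OF rhom_id] subst_Const[OF rhom_id]\<close>)
  have var: "Var i = r * Const (v $ i) + l i" for i
    by (simp add: r_def l_def rhom.one[OF rhom_Const] rhom.mult[OF rhom_Const, symmetric]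
      mult.commute[of _ "Const (v $ i)"] mult.assoc[symmetric])
  have "f = subst Const (\<lambda>i. r * Const (v $ i) + l i) f"
    using subst_Const_Var[of f] by (simp add: var[symmetric])
  also have "\<dots> = (\<Sum>b\<in>PiE UNIV (\<lambda>_. {..t}). Const (hasse b f (($) v)) * r ^ (t - (\<Sum>i\<in>UNIV. b i)) *
    (\<Prod>i\<in>UNIV. l i ^ b i))"
    by (rule taylor_form[OF rhom_Const f])
  also have "\<dots> \<in> ideal_power (point_ideal p) m"
  proof (rule ideal_power_sum)
    fix b :: "4 \<Rightarrow> nat" assume b: "b \<in> PiE UNIV (\<lambda>_. {..t})"
    show "Const (hasse b f (($) v)) * r ^ (t - (\<Sum>i\<in>UNIV. b i)) *
      (\<Prod>i\<in>UNIV. l i ^ b i) \<in> ideal_power (point_ideal p) m"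
    proof (cases "(\<Sum>i\<in>UNIV. b i) < m")
      case True
      then have "hasse b f (($) v) = 0" using m b by (simp add: vanish_iff_hasse[OF f])
      then show ?thesis by (simp add: Const_def zero_mem_ideal_power)
    next
      case False
      then have "(\<Prod>i\<in>UNIV. l i ^ b i) \<in> ideal_power (point_ideal p) m"
        using ideal_power_mono[OF ideal_power_prod[of UNIV l _ b]] l by auto
      then show ?thesis by (rule ideal_power_mult)
    qed
  qed
  finally show ?thesis .
qed

text \<open>From here on, ideals are replaced by orders of vanishing at chosen coordinate
  vectors.\<close>

lemma mem_symbolic_power_iff:
  fixes f :: "(4, 'a::field) mpoly"
  assumes "\<And>j. j < n \<Longrightarrow> P j \<in> proj3" "\<And>j. j < n \<Longrightarrow> v j \<in> P j" "is_form t f"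
  shows "f \<in> symbolic_power n P m \<longleftrightarrow> (\<forall>j<n. vanish m (($) (v j)) f)"
proof -
  have "f \<in> ideal_power (point_ideal (P j)) m \<longleftrightarrow> vanish m (($) (v j)) f" if "j < n" for j
    using vanish_point_power[of f "P j" m "v j"] form_mem_point_power[of "P j"
      "v j" t f m] that assms by blast
  then show ?thesis by (auto simp: symbolic_power_def)
qed

lemma symbolic_power_mult:
  "f \<in> symbolic_power n P a \<Longrightarrow> g \<in> symbolic_power n P b \<Longrightarrow> f * g \<in> symbolic_power n P (a + b)"
  by (auto simp: symbolic_power_def intro: ideal_power_add)

lemma symbolic_power_scale: "f \<in> symbolic_power n P a \<Longrightarrow> g * f \<in> symbolic_power n P a"
  by (auto simp: symbolic_power_def intro: ideal_power_mult)

subsection \<open>Vanishing on a grid\<close>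

lemma rhom_map_poly:
  assumes "rhom h" shows "rhom (map_poly h)"
proof -
  interpret rhom h by fact
  show ?thesis
    by unfold_locales (auto intro!: poly_eqI simp: coeff_map_poly add coeff_mult sum mult one map_poly_1)
qed

text \<open>Restriction to the linear subspace \<open>x\<^sub>j = c\<^sub>j x\<^sub>0\<close> (\<open>j \<notin> A \<union> {0}\<close>).\<close>

definition restrict_form :: "4 set \<Rightarrow> (4 \<Rightarrow> 'a) \<Rightarrow> (4, 'a::comm_ring_1) mpoly \<Rightarrow> (4, 'a) mpoly" where
  "restrict_form A c = subst Const (\<lambda>j. if j \<in> insert 0 A then Var j else Const (c j) * Var 0)"

lemma rhom_restrict: "rhom (restrict_form A c)"
  unfolding restrict_form_def by (rule rhom.rhom_subst[OF rhom_Const])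

lemma restrict_Const [simp]: "restrict_form A c (Const x) = Const x"
  by (simp add: restrict_form_def subst_Const rhom_Const)

lemma restrict_Var: "restrict_form A c (Var j) = (if j \<in> insert 0 A then Var j else Const (c j) * Var 0)"
  by (simp add: restrict_form_def subst_Var rhom_Const)

lemma restrict_restrict:
  "restrict_form A c (restrict_form B d f) = subst Const (\<lambda>j. restrict_form A c (if j \<in> insert 0 B then
    Var j else Const (d j) * Var 0)) f"
  unfolding restrict_form_def[of B] by (simp add: rhom_subst_comp[OF rhom_restrict])

lemma restrict_idem: "restrict_form A c (restrict_form A c f) = restrict_form A c f"
proof -
  have "(\<lambda>j. restrict_form A c (if j \<in> insert 0 A then Var j else Const (c j) * Var 0)) =
     (\<lambda>j. if j \<in> insert 0 A then Var j else Const (c j) * Var 0)"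
    by (auto simp: restrict_Var rhom.mult[OF rhom_restrict])
  then show ?thesis by (simp only: restrict_restrict) (simp add: restrict_form_def)
qed

text \<open>The set \<open>- {i}\<close> keeps every variable but \<open>i\<close>, so the outer
  restriction imposes the single equation x_i = a x_0.\<close>

lemma restrict_insert:
  assumes "i \<noteq> 0" "i \<notin> A"
  shows "restrict_form (- {i}) (\<lambda>_. a) (restrict_form (insert i A) c f) = restrict_form A (c(i := a)) f"
proof -
  have "(\<lambda>j. restrict_form (- {i}) (\<lambda>_. a) (if j \<in> insert 0 (insert i A) then Var j else Const (c j) *
    Var 0)) =
     (\<lambda>j. if j \<in> insert 0 A then Var j else Const ((c(i := a)) j) * Var 0)"
    using assms by (auto simp: restrict_Var rhom.mult[OF rhom_restrict])
  then show ?thesis by (simp only: restrict_restrict) (simp add: restrict_form_def)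
qed

lemma is_form_monom_eval:
  assumes "\<And>i. is_form 1 (x i :: (4, 'a::comm_ring_1) mpoly)"
  shows "is_form (mdeg u) (monom_eval x u)"
proof -
  have "is_form (\<Sum>i\<in>UNIV. lookup u i * 1) (\<Prod>i\<in>UNIV. x i ^ lookup u i)"
    by (intro is_form_prod is_form_power assms)
  then show ?thesis by (simp add: monom_eval_UNIV mdeg_def)
qed

lemma is_form_Const_mult: "is_form t f \<Longrightarrow> is_form t (Const c * f)" for f :: "(4, 'a::comm_ring_1) mpoly"
  using is_form_mult[OF is_form_Const] by fastforce

lemma is_form_restrict: "is_form t f \<Longrightarrow> is_form t (restrict_form A c f)"
  unfolding restrict_form_def subst_def
proof (intro is_form_sum is_form_Const_mult)
  fix u assume "is_form t f" "u \<in> keys f"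
  then have t: "t = mdeg u" by (simp add: is_form_alt)
  show "is_form t (monom_eval (\<lambda>j. if j \<in> insert 0 A then Var j else Const (c j) * Var 0 :: (4, 'a) mpoly) u)"
    unfolding t
  proof (rule is_form_monom_eval)
    show "is_form 1 (if j \<in> insert 0 A then Var j else Const (c j) * Var 0 :: (4, 'a) mpoly)" for j
      by (cases "j \<in> insert 0 A")
        (simp_all only: if_True if_False is_form_Var is_form_Const_mult[OF is_form_Var])
  qed
qed

text \<open>The subspace contains \<open>v\<close>, so restriction commutes with expansion at
  \<open>v\<close>: either way an eliminated x_j becomes c_j + s c_j x_0. Restriction thus acts on
  the coefficient of each power of \<open>s\<close>, and zero coefficients stay zero.\<close>

lemma vanish_restrict:
  assumes "vanish m v f" "v 0 = 1" "\<And>j. j \<notin> insert 0 A \<Longrightarrow> v j = c j"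
  shows "vanish m v (restrict_form A c f)"
proof -
  let ?R = "restrict_form A c"
  have R0: "?R 0 = 0" by (simp add: rhom.zero[OF rhom_restrict])
  have C1: "Const 1 = (1 :: (4, 'a) mpoly)" by (simp add: Const_def)
  have "map_poly ?R (expand v f) = subst (\<lambda>c. [:Const c:]) (\<lambda>i. map_poly ?R [:Const (v i), Var i:]) f"
    unfolding expand_def by (simp add: rhom_subst_comp[OF rhom_map_poly[OF rhom_restrict]] map_poly_pCons R0)
  also have "(\<lambda>i. map_poly ?R [:Const (v i), Var i:]) =
     (\<lambda>i. expand v (if i \<in> insert 0 A then Var i else Const (c i) * Var 0))"
    by (rule ext) (use assms(2,3) in \<open>auto simp: map_poly_pCons R0 restrict_Var rhom.mult[OF rhom_expand]
      expand_def subst_Var[OF rhom_pCons_Const] subst_Const[OF rhom_pCons_Const]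
        subst_times[OF rhom_pCons_Const] C1\<close>)
  also have "subst (\<lambda>c. [:Const c:]) (\<lambda>i. expand v (if i \<in> insert 0 A then Var i else Const (c i) * Var 0)) f
    = expand v (?R f)"
    unfolding restrict_form_def rhom_subst_comp[OF rhom_expand]
    by (simp add: expand_def subst_Const[OF rhom_pCons_Const])
  finally have "expand v (?R f) = map_poly ?R (expand v f)" ..
  then show ?thesis using assms(1) by (simp add: vanish_iff_coeff coeff_map_poly R0)
qed

text \<open>The factor theorem, monomial by monomial: x^e - y^e is divisible by x - y. The last
  clause guards the case t = 0, where the truncated \<open>t - 1\<close> would still admit a
  constant quotient.\<close>

lemma sub_restrict_dvd:
  assumes i: "i \<noteq> 0" and f: "is_form t f"
  shows "\<exists>q. f - restrict_form (- {i}) (\<lambda>_. a) f = (Var i - Const a * Var 0) * q \<and> is_form (t - 1) q \<and>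
    (t = 0 \<longrightarrow> q = 0)"
proof -
  let ?y = "Const a * Var 0 :: (4, 'a) mpoly"
  let ?x = "\<lambda>j. if j \<in> insert 0 (- {i}) then Var j else ?y"
  define q :: "(4 \<Rightarrow>\<^sub>0 nat) \<Rightarrow> (4, 'a) mpoly" where
    "q = (\<lambda>u. (\<Prod>j\<in>-{i}. Var j ^ lookup u j) * (\<Sum>k<lookup u i. ?y ^ (lookup u i - Suc k) * Var i ^ k))"
  have eq: "monom_eval Var u - monom_eval ?x u = (Var i - ?y) * q u" for u
  proof -
    have rem: "(\<Prod>j\<in>UNIV. F j) = F i * (\<Prod>j\<in>-{i}. F j)" for F :: "4 \<Rightarrow> (4, 'a) mpoly"
      by (simp add: prod.remove[of UNIV i] Compl_eq_Diff_UNIV)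
    have "monom_eval Var u - monom_eval ?x u = (Var i ^ lookup u i - ?y ^ lookup u i) *
      (\<Prod>j\<in>-{i}. Var j ^ lookup u j)"
      unfolding monom_eval_UNIV rem using i by (simp add: left_diff_distrib)
    then show ?thesis by (simp only: q_def power_diff_sumr2 mult.assoc mult.left_commute mult.commute)
  qed
  have q: "is_form (t - 1) (q u) \<and> (t = 0 \<longrightarrow> q u = 0)" if u: "mdeg u = t" for u
  proof (cases "lookup u i = 0")
    case False
    have "is_form ((\<Sum>j\<in>-{i}. lookup u j * 1) + (lookup u i - 1)) (q u)"
      unfolding q_def
    proof (intro is_form_mult is_form_prod is_form_power is_form_Var is_form_sum)
      fix k assume "k \<in> {..<lookup u i}"
      then have k: "lookup u i - 1 = (lookup u i - Suc k) * 1 + k * 1" by auto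
      show "is_form (lookup u i - 1) (?y ^ (lookup u i - Suc k) * Var i ^ k)"
        unfolding k by (intro is_form_mult is_form_power is_form_Const_mult is_form_Var)
    qed
    moreover have "mdeg u = (\<Sum>j\<in>-{i}. lookup u j) + lookup u i"
      unfolding mdeg_def by (subst sum.remove[of _ i]) (auto simp: Compl_eq_Diff_UNIV)
    ultimately show ?thesis using False u by simp
  qed (simp add: q_def)
  have "f - restrict_form (- {i}) (\<lambda>_. a) f = subst Const Var f - subst Const ?x f"
    by (simp add: subst_Const_Var restrict_form_def)
  also have "\<dots> = (Var i - ?y) * (\<Sum>u\<in>keys f. Const (lookup f u) * q u)"
    by (simp only: subst_def sum_subtractf[symmetric] right_diff_distrib[symmetric] eq sum_distrib_left
        mult.left_commute[of "Const _"])
  finally have "f - restrict_form (- {i}) (\<lambda>_. a) f = (Var i - ?y) * (\<Sum>u\<in>keys f. Const (lookup f u) * q u)" .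
  moreover have "is_form (t - 1) (\<Sum>u\<in>keys f. Const (lookup f u) * q u)"
    using q f by (intro is_form_sum is_form_Const_mult) (auto simp: is_form_alt)
  moreover have "(\<Sum>u\<in>keys f. Const (lookup f u) * q u) = 0" if "t = 0"
    by (rule sum.neutral) (use q f that in \<open>auto simp: is_form_alt\<close>)
  ultimately show ?thesis by blast
qed

text \<open>Since v_0 = 1, the linear form expands to (v_i - a) + s (x_i - a x_0). Off the
  hyperplane its constant term is a nonzero scalar, so the coefficients of \<open>q\<close> vanish
  one after another; on the hyperplane one factor \<open>s\<close> is lost.\<close>

lemma vanish_linear_mult:
  fixes q :: "(4, 'a::idom) mpoly"
  assumes i: "i \<noteq> 0" and v: "v 0 = 1" and van: "vanish m v ((Var i - Const a * Var 0) * q)"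
  shows "vanish (if v i = a then m - 1 else m) v q"
proof -
  let ?L = "Var i - Const a * Var 0 :: (4, 'a) mpoly"
  let ?q = "coeff (expand v q)"
  have L: "expand v ?L = [:Const (v i - a), ?L:]"
    by (simp add: expand_def subst_Var[OF rhom_pCons_Const] subst_Const[OF rhom_pCons_Const]
        subst_times[OF rhom_pCons_Const] subst_diff[OF rhom_pCons_Const] rhom.diff[OF rhom_Const] v)
      (simp add: Const_def)
  have "single 0 (Suc 0) \<noteq> single i (Suc 0)"
    using i by (metis lookup_single_eq lookup_single_not_eq n_not_Suc_n)
  then have "lookup ?L (single i 1) = 1"
    by (simp add: Var_def Const_def mult_single lookup_minus lookup_single when_def)
  then have L0: "?L \<noteq> 0" by (metis lookup_zero zero_neq_one)
  have co: "Const (v i - a) * ?q k + ?L * coeff (pCons 0 (expand v q)) k = 0" if "k < m" for k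
    using van that 
  proof -
    have "coeff (smult (Const (v i - a)) (expand v q) + pCons 0 (smult ?L (expand v q))) k = 0"
      using van that by (simp add: vanish_iff_coeff rhom.mult[OF rhom_expand] L)
    then show ?thesis by (cases k) simp_all
  qed
  show ?thesis
  proof (cases "v i = a")
    case True
    have "?q k = 0" if "k < m - 1" for k
      using co[of "Suc k"] that True L0 by (simp add: Const_def)
    then show ?thesis using True by (simp add: vanish_iff_coeff)
  next
    case False
    then have C0: "Const (v i - a) \<noteq> (0 :: (4, 'a) mpoly)"
      by (metis Const_def eq_iff_diff_eq_0 lookup_single_eq lookup_zero)
    have "?q k = 0" if "k < m" for k
      using that
    proof (induct k)
      case 0
      then show ?case using co[of 0] C0 by simp
    next
      case (Suc k)
      then show ?case using co[of "Suc k"] C0 by simp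
    qed
    then show ?thesis using False by (simp add: vanish_iff_coeff)
  qed
qed

text \<open>
  If \<open>f\<close> has order \<open>m\<close> on the grid and degree less than \<open>m\<close> times the number of hyperplanes
  \<open>x\<^sub>i = a\<close>, then by induction on the dimension \<open>f\<close> vanishes on one of these hyperplanes; dividing
  by its equation lowers the order only along that hyperplane. Hence the orders are allowed to
  depend on the hyperplane.
\<close>

lemma restrict_grid_eq_0:
  fixes S :: "'a::idom set"
  assumes "finite S" "finite A" "0 \<notin> A" "is_form t f" "t < card S * m"
    "\<And>v. v 0 = 1 \<Longrightarrow> (\<And>i. i \<in> A \<Longrightarrow> v i \<in> S) \<Longrightarrow> (\<And>i. i \<notin> insert 0 A \<Longrightarrow> v i = c i) \<Longrightarrow> vanish m v f"
  shows "restrict_form A c f = 0"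
  using assms(2-)
proof (induction A arbitrary: t f m c rule: finite_induct)
  case empty
  \<comment> \<open>No free coordinate is left: the subspace is one point, represented by
    \<open>c\<close> with zeroth entry 1, and \<open>f\<close> restricts to its value there times
    x_0^t.\<close>
  let ?c = "c(0 := 1)"
  have "vanish m ?c f" by (rule empty(4)) auto
  moreover have "m \<ge> Suc 0" using empty(3) by (cases m) auto
  ultimately have "vanish (Suc 0) ?c f" by (auto simp: vanish_iff_coeff)
  then have ev: "subst id ?c f = 0" by (simp add: vanish_1_iff eval_mpoly_eq_subst)
  have mon: "monom_eval (\<lambda>j. Const (?c j) * Var 0) u = Const (monom_eval ?c u) * Var 0 ^ mdeg u" for u
    by (simp add: monom_eval_UNIV rhom.prod[OF rhom_Const] rhom.power[OF rhom_Const] power_mult_distrib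
        prod.distrib power_sum[symmetric] mdeg_def del: fun_upd_apply)
  have "restrict_form {} c f = subst Const (\<lambda>j. Const (?c j) * Var 0) f"
    unfolding restrict_form_def by (rule arg_cong[of _ _ "\<lambda>x. subst Const x f"]) (auto simp: Const_def)
  also have "\<dots> = (\<Sum>u\<in>keys f. Const (lookup f u * monom_eval ?c u) * Var 0 ^ t)"
    unfolding subst_def mon
    by (rule sum.cong) (use empty(2) in \<open>auto simp: is_form_alt rhom.mult[OF rhom_Const]\<close>)
  also have "\<dots> = Const (subst id ?c f) * Var 0 ^ t"
    by (simp add: subst_def rhom.sum[OF rhom_Const] sum_distrib_right)
  finally show ?case using ev by (simp add: Const_def)
next
  case (insert i A)
  have i: "i \<noteq> 0" "i \<notin> A" using insert by auto
  \<comment> \<open>The order required on x_i = a x_0 is now \<open>\<mu> a\<close>, and the sum of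
    these orders replaces \<open>card S * m\<close>. In this form the bound survives division by a
    hyperplane.\<close>
  have "restrict_form (insert i A) c f = 0" if "is_form t f" "t < (\<Sum>a\<in>S. \<mu> a)"
    "\<And>v. v 0 = 1 \<Longrightarrow> (\<And>j. j \<in> insert i A \<Longrightarrow> v j \<in> S) \<Longrightarrow> (\<And>j. j \<notin> insert 0 (insert i A) \<Longrightarrow> v j = c j)
      \<Longrightarrow> vanish (\<mu> (v i)) v f" for f t \<mu>
    using that
  proof (induction t arbitrary: f \<mu> rule: less_induct)
    case (less t f \<mu>)
    let ?R = "restrict_form (insert i A) c"
    have ne: "S \<noteq> {}" using less.prems(2) by auto
    \<comment> \<open>For a hyperplane of largest order the sum is at most
      \<open>card S * \<mu> a\<close>, which gives the degree bound required one dimension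
      lower.\<close>
    define M where "M = Max (\<mu> ` S)"
    obtain a where a: "a \<in> S" "\<mu> a = M"
      using Max_in[of "\<mu> ` S"] ne \<open>finite S\<close> unfolding M_def by fastforce
    have "(\<Sum>a\<in>S. \<mu> a) \<le> card S * \<mu> a"
      using sum_bounded_above[of S \<mu> M] \<open>finite S\<close> a(2) by (simp add: M_def)
    then have t: "t < card S * \<mu> a" using less.prems(2) by linarith
    have "restrict_form A (c(i := a)) f = 0"
    proof (rule insert.IH[OF _ less.prems(1) t])
      fix v assume v: "v 0 = 1" "\<And>j. j \<in> A \<Longrightarrow> v j \<in> S" "\<And>j. j \<notin> insert 0 A \<Longrightarrow> v j = (c(i := a)) j"
      have vi: "v i = a" using v(3)[of i] i by simp
      have "vanish (\<mu> (v i)) v f"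
        by (rule less.prems(3)) (use v vi a in \<open>auto split: if_splits\<close>)
      then show "vanish (\<mu> a) v f" by (simp add: vi)
    qed (use insert.prems in auto)
    then have R0: "restrict_form (- {i}) (\<lambda>_. a) (?R f) = 0"
      by (simp only: restrict_insert[OF i])
    obtain q where q': "?R f - restrict_form (- {i}) (\<lambda>_. a) (?R f) = (Var i - Const a * Var 0) * q"
      and q2: "is_form (t - 1) q" "t = 0 \<longrightarrow> q = 0"
      using sub_restrict_dvd[OF i(1) is_form_restrict[OF less.prems(1)]] by blast
    have q: "?R f = (Var i - Const a * Var 0) * q"
      using q' unfolding R0 by simp
    have "?R q = 0"
    proof (cases "t = 0")
      case False
      \<comment> \<open>Division costs one degree and one unit of order on a single hyperplane, so
        the strict inequality is preserved.\<close>
      let ?\<mu> = "\<mu>(a := \<mu> a - 1)"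
      have pos: "\<mu> a > 0" using t by (cases "\<mu> a") auto
      show ?thesis
      proof (rule less.IH)
        show "t - 1 < (\<Sum>a\<in>S. ?\<mu> a)"
          using less.prems(2) False pos a(1) \<open>finite S\<close> by (simp add: sum.remove[of S a])
      next
        fix v assume v: "v 0 = 1" "\<And>j. j \<in> insert i A \<Longrightarrow> v j \<in> S" 
          "\<And>j. j \<notin> insert 0 (insert i A) \<Longrightarrow> v j = c j"
        have "vanish (\<mu> (v i)) v (?R f)"
          by (intro vanish_restrict less.prems(3)) (use v in auto)
        from vanish_linear_mult[OF i(1) v(1) this[unfolded q]]
        show "vanish (?\<mu> (v i)) v q" by (auto split: if_splits)
      qed (use False q2 in auto)
    qed (use q2 rhom.zero[OF rhom_restrict] in auto)
    \<comment> \<open>Only the restriction of \<open>q\<close> is known to be zero, so the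
      factorization is restricted once more, which leaves its left side unchanged.\<close>
    moreover have "?R f = ?R (Var i - Const a * Var 0) * ?R q"
      using arg_cong[OF q, of ?R] by (simp only: restrict_idem rhom.mult[OF rhom_restrict])
    ultimately show ?case by simp
  qed
  from this[of t f "\<lambda>_. m"] insert.prems show ?case by simp
qed


lemma grid_form_eq_0:
  fixes S :: "'a::idom set"
  assumes "finite S" "is_form t f" "t < card S * m"
    "\<And>v. v 0 = 1 \<Longrightarrow> (\<And>i. i \<noteq> 0 \<Longrightarrow> v i \<in> S) \<Longrightarrow> vanish m v f"
  shows "f = 0"
proof -
  have "restrict_form (- {0}) (\<lambda>_. 0) f = 0"
    by (rule restrict_grid_eq_0[OF assms(1) _ _ assms(2,3)]) (use assms(4) in auto)
  moreover have "restrict_form (- {0}) (\<lambda>_. 0) f = subst Const Var f"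
    unfolding restrict_form_def by (rule arg_cong[of _ _ "\<lambda>x. subst Const x f"]) auto
  ultimately show ?thesis by (simp add: subst_Const_Var)
qed

subsection \<open>Multihomogeneous functions and Zariski-open sets\<close>

text \<open>Functions instead of polynomials let matrix entries be multiplied and subtracted
  pointwise; the polynomial is recovered only when an open set is produced.\<close>

definition mhom_fun :: "nat \<Rightarrow> (nat \<Rightarrow> nat) \<Rightarrow> ((nat \<Rightarrow> 'a::field ^ 4) \<Rightarrow> 'a) \<Rightarrow> bool" where
  "mhom_fun n d \<phi> \<longleftrightarrow> (\<exists>f. multihomogeneous n d f \<and> \<phi> = (\<lambda>v. eval_mpoly (\<lambda>(j, i). v j $ i) f))"

lemma mhom_fun_0: "mhom_fun n d (\<lambda>_. 0)"
  unfolding mhom_fun_def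
  by (rule exI[of _ 0]) (simp add: multihomogeneous_def eval_mpoly_def)

lemma mhom_fun_const: "mhom_fun n (\<lambda>_. 0) (\<lambda>_. c)"
  unfolding mhom_fun_def
  by (rule exI[of _ "Const c"])
    (simp add: multihomogeneous_def eval_mpoly_eq_subst subst_Const[OF rhom_id], simp add: Const_def)

lemma mhom_fun_coord:
  assumes "j < n"
  shows "mhom_fun n (\<lambda>k. if k = j then 1 else 0) (\<lambda>v. v j $ i)"
proof -
  have "multihomogeneous n (\<lambda>k. if k = j then 1 else 0) (Var (j, i) :: (nat \<times> 4, 'a) mpoly)"
    using assms by (auto simp: multihomogeneous_def Var_def lookup_single when_def sum.delta')
  then show ?thesis unfolding mhom_fun_def
    by (intro exI[of _ "Var (j, i)"]) (simp add: eval_mpoly_eq_subst subst_Var[OF rhom_id])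
qed

lemma mhom_fun_diff:
  assumes "mhom_fun n d \<phi>" "mhom_fun n d \<psi>"
  shows "mhom_fun n d (\<lambda>v. \<phi> v - \<psi> v)"
proof -
  from assms obtain f g where f: "multihomogeneous n d f" "\<phi> = (\<lambda>v. eval_mpoly (\<lambda>(j, i). v j $ i) f)"
    and g: "multihomogeneous n d g" "\<psi> = (\<lambda>v. eval_mpoly (\<lambda>(j, i). v j $ i) g)"
    unfolding mhom_fun_def by blast
  have "multihomogeneous n d (f - g)"
    using f(1) g(1) keys_diff[of f g] by (fastforce simp: multihomogeneous_def)
  then show ?thesis unfolding mhom_fun_def
    by (intro exI[of _ "f - g"]) (simp add: f(2) g(2) eval_mpoly_eq_subst subst_diff[OF rhom_id])
qed

lemma mhom_fun_mult:
  assumes "mhom_fun n d \<phi>" "mhom_fun n e \<psi>"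
  shows "mhom_fun n (\<lambda>j. d j + e j) (\<lambda>v. \<phi> v * \<psi> v)"
proof -
  from assms obtain f g where f: "multihomogeneous n d f" "\<phi> = (\<lambda>v. eval_mpoly (\<lambda>(j, i). v j $ i) f)"
    and g: "multihomogeneous n e g" "\<psi> = (\<lambda>v. eval_mpoly (\<lambda>(j, i). v j $ i) g)"
    unfolding mhom_fun_def by blast
  have "multihomogeneous n (\<lambda>j. d j + e j) (f * g)"
    unfolding multihomogeneous_def
  proof
    fix w assume "w \<in> keys (f * g)"
    then obtain a b where w: "w = a + b" "a \<in> keys f" "b \<in> keys g"
      using keys_mult[of f g] by auto
    then show "keys w \<subseteq> {..<n} \<times> UNIV \<and> (\<forall>j<n. (\<Sum>i\<in>UNIV. lookup w (j, i)) = d j + e j)"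
      using f(1) g(1) subset_trans[OF keys_add[of a b], of "{..<n} \<times> UNIV"]
      by (simp add: multihomogeneous_def lookup_add sum.distrib)
  qed
  then show ?thesis unfolding mhom_fun_def
    by (intro exI[of _ "f * g"]) (simp add: f(2) g(2) eval_mpoly_eq_subst subst_times[OF rhom_id])
qed

lemma mhom_fun_power: "mhom_fun n d \<phi> \<Longrightarrow> mhom_fun n (\<lambda>j. k * d j) (\<lambda>v. \<phi> v ^ k)"
  by (induct k) (simp_all add: mhom_fun_const mhom_fun_mult)

lemma mhom_fun_prod:
  "(\<And>i. i \<in> A \<Longrightarrow> mhom_fun n (d i) (\<phi> i)) \<Longrightarrow> mhom_fun n (\<lambda>j. \<Sum>i\<in>A. d i j) (\<lambda>v. \<Prod>i\<in>A. \<phi> i v)"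
  by (induct A rule: infinite_finite_induct) (simp_all add: mhom_fun_const mhom_fun_mult)

text \<open>The multidegree is independent of \<open>u\<close>, hence constant along the row
  \<open>(j, b)\<close> of the vanishing conditions, as elimination requires. Zero entries fit
  because the zero function has every multidegree.\<close>

lemma mhom_fun_hasse:
  fixes u :: "4 \<Rightarrow>\<^sub>0 nat"
  assumes j: "j < n" and u: "mdeg u = t"
  shows "mhom_fun n (\<lambda>k. if k = j then t - (\<Sum>i\<in>UNIV. b i) else 0)
    (\<lambda>v :: nat \<Rightarrow> 'a::field ^ 4. hasse_monom b u (($) (v j)))"
proof (cases "\<forall>i. b i \<le> lookup u i")
  case True
  then have deg: "(\<Sum>i\<in>UNIV. lookup u i - b i) = t - (\<Sum>i\<in>UNIV. b i)"
    using u by (simp add: sum_subtractf_nat mdeg_def)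
  have "mhom_fun n (\<lambda>k. \<Sum>i\<in>UNIV. 0 + (lookup u i - b i) * (if k = j then 1 else 0))
    (\<lambda>v :: nat \<Rightarrow> 'a ^ 4. hasse_monom b u (($) (v j)))"
    unfolding hasse_monom_def
    by (intro mhom_fun_prod mhom_fun_mult mhom_fun_const mhom_fun_power mhom_fun_coord j)
  also have "(\<lambda>k. \<Sum>i\<in>UNIV. 0 + (lookup u i - b i) * (if k = j then 1 else 0)) =
      (\<lambda>k. if k = j then t - (\<Sum>i\<in>UNIV. b i) else 0)"
    by (auto simp: deg)
  finally show ?thesis .
next
  case False
  then have "hasse_monom b u a = 0" for a :: "4 \<Rightarrow> 'a" by (meson hasse_monom_eq_0 not_le)
  then show ?thesis by (simp add: mhom_fun_0)
qed

text \<open>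
  The non-vanishing of a maximal minor, obtained by fraction-free Gaussian elimination: clearing a
  column with a pivot row keeps all entries of a row of the same multidegree.
\<close>

lemma trivial_kernel_open:
  fixes A :: "'r \<Rightarrow> 'c \<Rightarrow> (nat \<Rightarrow> 'a::field ^ 4) \<Rightarrow> 'a"
  assumes "finite C" "\<And>r c. r \<in> R \<Longrightarrow> c \<in> C \<Longrightarrow> mhom_fun n (e r) (A r c)"
    "\<And>x. (\<And>r. r \<in> R \<Longrightarrow> (\<Sum>c\<in>C. A r c v0 * x c) = 0) \<Longrightarrow> \<forall>c\<in>C. x c = 0"
  shows "\<exists>d D. mhom_fun n d D \<and> D v0 \<noteq> 0 \<and>
    (\<forall>v. D v \<noteq> 0 \<longrightarrow> (\<forall>x. (\<forall>r\<in>R. (\<Sum>c\<in>C. A r c v * x c) = 0) \<longrightarrow> (\<forall>c\<in>C. x c = 0)))"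
  using assms
proof (induction C arbitrary: A e rule: finite_induct)
  case empty
  show ?case by (intro exI conjI, rule mhom_fun_const[of n 1]) auto
next
  case (insert c0 C)
  have "\<exists>r0\<in>R. A r0 c0 v0 \<noteq> 0"
  proof (rule ccontr)
    assume *: "\<not> ?thesis"
    \<comment> \<open>If column \<open>c0\<close> were zero at \<open>v0\<close>, its unit vector
      would lie in the kernel.\<close>
    let ?x = "\<lambda>c. if c = c0 then 1 else 0 :: 'a"
    have "\<forall>c\<in>insert c0 C. ?x c = 0"
      by (rule insert.prems(2)) (use * insert.hyps in \<open>auto simp: sum.neutral\<close>)
    then show False by simp
  qed
  then obtain r0 where r0: "r0 \<in> R" "A r0 c0 v0 \<noteq> 0" by blast
  define B where "B = (\<lambda>r c v. A r0 c0 v * A r c v - A r c0 v * A r0 c v)"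
  have B_sum: "(\<Sum>c\<in>C. B r c v * x c) = A r0 c0 v * (\<Sum>c\<in>C. A r c v * x c) - A r c0 v * (\<Sum>c\<in>C. A r0 c v * x c)"
    for r v and x :: "'c \<Rightarrow> 'a"
    by (simp add: B_def sum_distrib_left sum_subtractf left_diff_distrib mult.assoc)
  have "\<exists>d D. mhom_fun n d D \<and> D v0 \<noteq> 0 \<and>
    (\<forall>v. D v \<noteq> 0 \<longrightarrow> (\<forall>x. (\<forall>r\<in>R. (\<Sum>c\<in>C. B r c v * x c) = 0) \<longrightarrow> (\<forall>c\<in>C. x c = 0)))"
  proof (rule insert.IH)
    fix r c assume rc: "r \<in> R" "c \<in> C"
    have "mhom_fun n (\<lambda>j. e r0 j + e r j) (\<lambda>v. A r0 c0 v * A r c v)"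
      by (intro mhom_fun_mult insert.prems) (use rc r0 in auto)
    moreover have "mhom_fun n (\<lambda>j. e r j + e r0 j) (\<lambda>v. A r c0 v * A r0 c v)"
      by (intro mhom_fun_mult insert.prems) (use rc r0 in auto)
    ultimately show "mhom_fun n (\<lambda>j. e r j + e r0 j) (B r c)"
      unfolding B_def by (intro mhom_fun_diff) (simp_all add: add.commute)
  next
    fix x assume x: "\<And>r. r \<in> R \<Longrightarrow> (\<Sum>c\<in>C. B r c v0 * x c) = 0"
    \<comment> \<open>The value at \<open>c0\<close> solves the pivot row; a kernel vector of the
      reduced matrix thus extends to one of the full matrix.\<close>
    define y where "y = x(c0 := - (\<Sum>c\<in>C. A r0 c v0 * x c) / A r0 c0 v0)"
    have y: "(\<Sum>c\<in>C. A r c v0 * y c) = (\<Sum>c\<in>C. A r c v0 * x c)" for r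
      by (rule sum.cong) (use insert.hyps in \<open>auto simp: y_def\<close>)
    have "\<forall>c\<in>insert c0 C. y c = 0"
    proof (rule insert.prems(2))
      fix r assume "r \<in> R"
      from x[OF this] r0 show "(\<Sum>c\<in>insert c0 C. A r c v0 * y c) = 0"
        using insert.hyps by (simp add: y B_sum) (simp add: y_def field_simps)
    qed
    then show "\<forall>c\<in>C. x c = 0" using insert.hyps by (auto simp: y_def split: if_splits)
  qed
  then obtain d D where D: "mhom_fun n d D" "D v0 \<noteq> 0"
    "\<forall>v. D v \<noteq> 0 \<longrightarrow> (\<forall>x. (\<forall>r\<in>R. (\<Sum>c\<in>C. B r c v * x c) = 0) \<longrightarrow> (\<forall>c\<in>C. x c = 0))"
    by (elim exE conjE)
  have ker: "\<forall>c\<in>insert c0 C. x c = 0" if v: "A r0 c0 v * D v \<noteq> 0"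
    and x: "\<forall>r\<in>R. (\<Sum>c\<in>insert c0 C. A r c v * x c) = 0" for v x
  proof -
    have *: "(\<Sum>c\<in>C. A r c v * x c) = - A r c0 v * x c0" if "r \<in> R" for r
      using x that insert.hyps by (simp add: eq_neg_iff_add_eq_0 add.commute)
    have C: "\<forall>c\<in>C. x c = 0"
      by (rule D(3)[THEN spec, THEN mp, THEN spec, THEN mp, of v])
        (use v r0 in \<open>simp_all add: B_sum *\<close>)
    then have "(\<Sum>c\<in>C. A r0 c v * x c) = 0" by simp
    with *[OF r0(1)] v C show ?thesis by auto
  qed
  show ?case
  proof (intro exI conjI allI impI)
    show "mhom_fun n (\<lambda>j. e r0 j + d j) (\<lambda>v. A r0 c0 v * D v)"
      by (intro mhom_fun_mult insert.prems D) (use r0 in auto)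
    show "A r0 c0 v0 * D v0 \<noteq> 0" using r0 D(2) by simp
  qed (rule ker)
qed

section \<open>Irreducibility of the product of projective spaces\<close>

lemma eval_line:
  fixes f :: "(nat \<times> 4, 'a::field) mpoly" and x y :: "nat \<Rightarrow> 'a ^ 4"
  shows "\<exists>p. \<forall>s. poly p s = eval_mpoly (\<lambda>(j, i). (x j + s *s (y j - x j)) $ i) f"
proof (intro exI allI)
  fix s
  have "poly (subst (\<lambda>c. [:c:]) (\<lambda>k. [:x (fst k) $ snd k, (y (fst k) - x (fst k)) $ snd k:]) f) s =
      subst id (\<lambda>k. (x (fst k) + s *s (y (fst k) - x (fst k))) $ snd k) f"
    by (simp add: rhom_subst_comp[OF rhom_poly] id_def right_diff_distrib)
  then show "poly (subst (\<lambda>c. [:c:]) (\<lambda>k. [:x (fst k) $ snd k, (y (fst k) - x (fst k)) $ snd k:]) f) s =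
      eval_mpoly (\<lambda>(j, i). (x j + s *s (y j - x j)) $ i) f"
    by (simp only: eval_mpoly_eq_subst case_prod_unfold)
qed

text \<open>Join representatives of a tuple in \<open>U\<close> to those of a tuple in
  \<open>W\<close>. Along this line each of the two chosen polynomials becomes a nonzero polynomial
  in \<open>s\<close> and excludes finitely many values. So does the demand that each vector be
  nonzero and hence represent a point.\<close>

lemma zariski_open_Int_nonempty:
  fixes U W :: "(nat \<Rightarrow> ('a::field_char_0 ^ 4) set) set"
  assumes "zariski_open n U" "zariski_open n W" "U \<noteq> {}" "W \<noteq> {}"
  shows "U \<inter> W \<noteq> {}"
proof -
  from assms(1) obtain F where U: "U = {P \<in> {..<n} \<rightarrow>\<^sub>E proj3.
    \<exists>f\<in>F. \<exists>v. (\<forall>j<n. v j \<in> P j) \<and> eval_mpoly (\<lambda>(j, i). v j $ i) f \<noteq> 0}"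
    unfolding zariski_open_def by blast
  from assms(2) obtain G where W: "W = {P \<in> {..<n} \<rightarrow>\<^sub>E proj3.
    \<exists>f\<in>G. \<exists>v. (\<forall>j<n. v j \<in> P j) \<and> eval_mpoly (\<lambda>(j, i). v j $ i) f \<noteq> 0}"
    unfolding zariski_open_def by blast
  from assms(3) obtain P f x where x: "P \<in> {..<n} \<rightarrow>\<^sub>E proj3" "f \<in> F" "\<forall>j<n. x j \<in> P j"
    "eval_mpoly (\<lambda>(j, i). x j $ i) f \<noteq> 0"
    unfolding U by blast
  from assms(4) obtain Q g y where y: "g \<in> G" "eval_mpoly (\<lambda>(j, i). y j $ i) g \<noteq> 0"
    unfolding W by blast
  define z where "z = (\<lambda>s j. x j + s *s (y j - x j))"
  obtain p where p: "\<And>s. poly p s = eval_mpoly (\<lambda>(j, i). z s j $ i) f"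
    using eval_line[of x y f] unfolding z_def by blast
  obtain q where q: "\<And>s. poly q s = eval_mpoly (\<lambda>(j, i). z s j $ i) g"
    using eval_line[of x y g] unfolding z_def by blast
  have z01: "z 0 = x" "z 1 = y" by (auto simp: z_def)
  have "p \<noteq> 0" "q \<noteq> 0" using p[of 0] q[of 1] x(4) y(2) z01 by auto
  moreover have "finite {s. z s j = 0}" if "j < n" for j
  proof -
    have "x j \<noteq> 0" using x that proj3_nonzero[of "P j" "x j"] by auto
    then obtain i where i: "x j $ i \<noteq> 0" by (auto simp: vec_eq_iff)
    have "{s. z s j = 0} \<subseteq> {s. poly [:x j $ i, (y j - x j) $ i:] s = 0}"
      by (auto simp: z_def vec_eq_iff right_diff_distrib)
    moreover have "finite \<dots>" by (rule poly_roots_finite) (use i in auto)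
    ultimately show ?thesis by (rule finite_subset)
  qed
  ultimately have "finite ({s. poly p s = 0} \<union> {s. poly q s = 0} \<union> (\<Union>j<n. {s. z s j = 0}))"
    by (auto intro: poly_roots_finite)
  from ex_new_if_finite[OF infinite_UNIV_char_0 this]
    obtain s where "s \<notin> {s. poly p s = 0} \<union> {s. poly q s = 0} \<union> (\<Union>j<n. {s. z s j = 0})"
    ..
  then have s: "poly p s \<noteq> 0" "poly q s \<noteq> 0" "\<And>j. j < n \<Longrightarrow> z s j \<noteq> 0" by auto
  have "\<forall>j\<in>{..<n}. \<exists>p. p \<in> proj3 \<and> z s j \<in> p" using ex_proj3 s(3) by blast
  from bchoice[OF this] obtain R where
    R: "\<And>j. j < n \<Longrightarrow> R j \<in> proj3" "\<And>j. j < n \<Longrightarrow> z s j \<in> R j" by auto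
  have R': "restrict R {..<n} \<in> {..<n} \<rightarrow>\<^sub>E proj3" "\<forall>j<n. z s j \<in> restrict R {..<n} j"
    using R by auto
  have "restrict R {..<n} \<in> U" unfolding U using R' x(2) s(1) unfolding p by blast
  moreover have "restrict R {..<n} \<in> W" unfolding W using R' y(1) s(2) unfolding q by blast
  ultimately show ?thesis by blast
qed

subsection \<open>The initial degree for general points\<close>

lemma Var_neq_0: "Var i \<noteq> (0 :: ('v, 'a::comm_ring_1) mpoly)"
  by (metis Var_def lookup_single_eq lookup_zero zero_neq_one)

lemma ex_linear_form:
  assumes "p \<in> proj3"
  shows "\<exists>l \<in> point_ideal p. l \<noteq> (0 :: (4, 'a::field) mpoly) \<and> is_form 1 l"
proof -
  obtain v where v: "v \<in> p" using proj3_nonempty[OF assms] ..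
  obtain k where k: "v $ k \<noteq> 0" using proj3_nonzero[OF assms v] by (auto simp: vec_eq_iff)
  obtain i :: 4 where i: "i \<noteq> k" using zero_neq_one by metis
  define l where "l = Const (v $ k) * Var i - Const (v $ i) * Var k"
  have "l \<in> point_ideal p"
    by (rule linear_mem_point_ideal[OF assms v _ l_def])
      (simp add: l_def eval_mpoly_eq_subst subst_diff[OF rhom_id] subst_times[OF rhom_id]
        subst_Var[OF rhom_id] subst_Const[OF rhom_id])
  moreover have "single k (Suc 0) \<noteq> single i (Suc 0)"
    using i by (metis lookup_single_eq lookup_single_not_eq n_not_Suc_n)
  then have "lookup l (single i 1) = v $ k"
    by (simp add: l_def Var_def Const_def mult_single lookup_minus lookup_single when_def)
  then have "l \<noteq> 0" using k by auto
  moreover have "is_form 1 l" unfolding l_def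
    by (intro is_form_diff is_form_Const_mult is_form_Var)
  ultimately show ?thesis by blast
qed

text \<open>Multiply the m-th powers of linear forms, one through each point. This makes the
  \<open>LEAST\<close> in \<open>initial_degree\<close> meaningful, and since the degree is uniform
  in the points, a maximum over tuples exists.\<close>

lemma symbolic_power_nonzero_form:
  assumes "P \<in> {..<n} \<rightarrow>\<^sub>E (proj3 :: ('a::field ^ 4) set set)"
  shows "\<exists>f\<in>symbolic_power n P m. f \<noteq> 0 \<and> is_form (n * m) f"
proof -
  have "\<forall>j\<in>{..<n}. \<exists>l. l \<in> point_ideal (P j) \<and> l \<noteq> 0 \<and> is_form 1 l"
    using assms ex_linear_form by blast
  from bchoice[OF this] obtain l where l: "\<And>j. j < n \<Longrightarrow> l j \<in> point_ideal (P j)"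
    "\<And>j. j < n \<Longrightarrow> l j \<noteq> 0" "\<And>j. j < n \<Longrightarrow> is_form 1 (l j)" by auto
  let ?f = "\<Prod>j<n. l j ^ m"
  have "?f \<in> ideal_power (point_ideal (P j)) m" if "j < n" for j
  proof -
    have "?f = (\<Prod>j\<in>{..<n} - {j}. l j ^ m) * l j ^ m"
      using that by (subst prod.remove[of _ j]) (auto simp: mult.commute)
    then show ?thesis using ideal_power_mult[OF ideal_power_power[OF l(1)[OF that]]] by simp
  qed
  moreover have "?f \<noteq> 0" using l(2) by auto
  moreover have "is_form (\<Sum>j<n. m * 1) ?f"
    by (intro is_form_prod is_form_power l(3)) simp
  ultimately show ?thesis by (intro bexI[of _ ?f]) (simp_all add: symbolic_power_def)
qed

lemma initial_degree_le: "f \<in> J \<Longrightarrow> f \<noteq> 0 \<Longrightarrow> is_form t f \<Longrightarrow> initial_degree J \<le> t"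
  unfolding initial_degree_def by (rule Least_le) blast

lemma initial_degree_attained:
  assumes "P \<in> {..<n} \<rightarrow>\<^sub>E (proj3 :: ('a::field ^ 4) set set)"
  shows "\<exists>f\<in>symbolic_power n P m. f \<noteq> 0 \<and> is_form (initial_degree (symbolic_power n P m)) f"
  unfolding initial_degree_def
  using LeastI[of "\<lambda>t. \<exists>f\<in>symbolic_power n P m. f \<noteq> 0 \<and>
    is_form t f", OF symbolic_power_nonzero_form[OF assms]] .

lemma reps_exist:
  assumes "P \<in> {..<n} \<rightarrow>\<^sub>E proj3"
  shows "\<exists>v. \<forall>j<n. v j \<in> P j"
proof -
  have "\<forall>j\<in>{..<n}. \<exists>w. w \<in> P j" using assms proj3_nonempty by blast
  from bchoice[OF this] show ?thesis by auto
qed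

text \<open>A form of degree \<open>t\<close> is a vector indexed by monomials, and the Hasse
  derivatives give a matrix with rows \<open>(j, b)\<close>. Absence of nonzero forms is triviality
  of its kernel, which is detected by nonvanishing minors.\<close>

lemma zariski_open_no_form:
  "zariski_open n {P \<in> {..<n} \<rightarrow>\<^sub>E (proj3 :: ('a::field ^ 4) set set).
     \<forall>f\<in>symbolic_power n P m. is_form t f \<longrightarrow> f = 0}"
proof -
  define C where "C = {u. mdeg u = t}"
  define R where "R = {(j, b). j < n \<and> b \<in> PiE (UNIV :: 4 set) (\<lambda>_. {..t}) \<and> (\<Sum>i\<in>UNIV. b i) < m}"
  define A :: "nat \<times> (4 \<Rightarrow> nat) \<Rightarrow> (4 \<Rightarrow>\<^sub>0 nat) \<Rightarrow> (nat \<Rightarrow> 'a ^ 4) \<Rightarrow> 'a" where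
    "A = (\<lambda>(j, b) u v. hasse_monom b u (($) (v j)))"
  define K where "K v \<longleftrightarrow> (\<forall>x. (\<forall>r\<in>R. (\<Sum>u\<in>C. A r u v * x u) = 0) \<longrightarrow> (\<forall>u\<in>C. x u = 0))" for v
  \<comment> \<open>Taking all polynomials whose nonvanishing forces a trivial kernel makes one
    inclusion immediate; the other needs just one such polynomial at each good tuple.\<close>
  define F where "F = {f. (\<exists>d. multihomogeneous n d f) \<and> (\<forall>v. eval_mpoly (\<lambda>(j, i). v j $ i) f \<noteq> 0 \<longrightarrow> K v)}"
  have fin: "finite C" unfolding C_def by (rule finite_mdeg)
  have sys: "(\<forall>r\<in>R. (\<Sum>u\<in>C. A r u v * lookup f u) = 0) \<longleftrightarrow> (\<forall>j<n. vanish m (($) (v j)) f)"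
    if f: "is_form t f" for f v
  proof -
    have "hasse b f a = (\<Sum>u\<in>C. hasse_monom b u a * lookup f u)" for b a
      unfolding hasse_def
      by (subst sum.mono_neutral_left[of C "keys f"])
        (use f fin in \<open>auto simp: is_form_alt C_def in_keys_iff mult.commute\<close>)
    then show ?thesis unfolding vanish_iff_hasse[OF f] R_def A_def by auto
  qed
  have K: "K v \<longleftrightarrow> (\<forall>f\<in>symbolic_power n P m. is_form t f \<longrightarrow> f = 0)"
    if P: "P \<in> {..<n} \<rightarrow>\<^sub>E proj3" and v: "\<forall>j<n. v j \<in> P j" for P v
  proof
    have mem: "f \<in> symbolic_power n P m \<longleftrightarrow> (\<forall>j<n. vanish m (($) (v j)) f)" if "is_form t f" for f
      using mem_symbolic_power_iff[of n P v, OF _ _ that] P v by auto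
    show "\<forall>f\<in>symbolic_power n P m. is_form t f \<longrightarrow> f = 0" if "K v"
    proof (intro ballI impI)
      fix f assume f: "f \<in> symbolic_power n P m" "is_form t f"
      then have "\<forall>r\<in>R. (\<Sum>u\<in>C. A r u v * lookup f u) = 0"
        using sys[OF f(2)] mem[OF f(2)] f(1) by simp
      then have C0: "\<forall>u\<in>C. lookup f u = 0"
        by (rule that[unfolded K_def, THEN spec, THEN mp])
      have "lookup f u = 0" for u
        using C0 f(2) by (cases "u \<in> C") (auto simp: C_def is_form_alt in_keys_iff)
      then show "f = 0" by (intro poly_mapping_eqI) simp
    qed
    show "K v" if *: "\<forall>f\<in>symbolic_power n P m. is_form t f \<longrightarrow> f = 0"
      unfolding K_def
    proof (rule allI, rule impI)
      fix x assume x: "\<forall>r\<in>R. (\<Sum>u\<in>C. A r u v * x u) = 0"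
      define f where "f = (\<Sum>u\<in>C. single u (x u))"
      have lk: "lookup f u = x u" if "u \<in> C" for u
        using that fin by (simp add: f_def lookup_sum lookup_single when_def sum.delta)
      have form: "is_form t f" unfolding f_def
        by (intro is_form_sum is_form_single) (simp add: C_def)
      have "\<forall>r\<in>R. (\<Sum>u\<in>C. A r u v * lookup f u) = 0" using x by (simp add: lk)
      then have "f \<in> symbolic_power n P m" using sys[OF form] mem[OF form] by simp
      then have "f = 0" using * form by simp
      then show "\<forall>u\<in>C. x u = 0" using lk by simp
    qed
  qed
  show ?thesis
    unfolding zariski_open_def
  proof (intro exI[of _ F] conjI)
    show "\<forall>f\<in>F. \<exists>d. multihomogeneous n d f" by (auto simp: F_def)
    have eq: "(\<forall>f\<in>symbolic_power n P m. is_form t f \<longrightarrow> f = 0) \<longleftrightarrow>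
      (\<exists>f\<in>F. \<exists>v. (\<forall>j<n. v j \<in> P j) \<and> eval_mpoly (\<lambda>(j, i). v j $ i) f \<noteq> 0)"
      (is "?L \<longleftrightarrow> ?R") if P: "P \<in> {..<n} \<rightarrow>\<^sub>E (proj3 :: ('a ^ 4) set set)" for P
    proof
      assume ?R
      then obtain f v where "f \<in> F" "\<forall>j<n. v j \<in> P j" "eval_mpoly (\<lambda>(j, i). v j $ i) f \<noteq> 0" by blast
      then show ?L using K[OF P] unfolding F_def by blast
    next
      assume L: ?L
      obtain v where v: "\<forall>j<n. v j \<in> P j" using reps_exist[OF P] ..
      have Kv: "K v" using K[OF P v] L by blast
      have "\<exists>d D. mhom_fun n d D \<and> D v \<noteq> 0 \<and> (\<forall>v. D v \<noteq> 0 \<longrightarrow> K v)"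
        unfolding K_def
      proof (rule trivial_kernel_open[OF fin])
        show "\<forall>u\<in>C. x u = 0" if "\<And>r. r \<in> R \<Longrightarrow> (\<Sum>u\<in>C. A r u v * x u) = 0" for x
          by (rule Kv[unfolded K_def, THEN spec, THEN mp]) (use that in simp)
        show "mhom_fun n ((\<lambda>(j, b) k. if k = j then t - (\<Sum>i\<in>UNIV. b i) else 0) r) (A r u)"
          if "r \<in> R" "u \<in> C" for r u
          using that by (auto simp: A_def R_def C_def intro: mhom_fun_hasse)
      qed
      then obtain d D where D: "mhom_fun n d D" "D v \<noteq> 0" "\<And>v. D v \<noteq> 0 \<Longrightarrow> K v" by blast
      then obtain f where "multihomogeneous n d f" "D = (\<lambda>v. eval_mpoly (\<lambda>(j, i). v j $ i) f)"
        unfolding mhom_fun_def by blast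
      then have "f \<in> F" "eval_mpoly (\<lambda>(j, i). v j $ i) f \<noteq> 0" using D by (auto simp: F_def)
      then show ?R using v by blast
    qed
    show "{P \<in> {..<n} \<rightarrow>\<^sub>E proj3. \<forall>f\<in>symbolic_power n P m. is_form t f \<longrightarrow> f = 0} =
      {P \<in> {..<n} \<rightarrow>\<^sub>E (proj3 :: ('a ^ 4) set set).
       \<exists>f\<in>F. \<exists>v. (\<forall>j<n. v j \<in> P j) \<and> eval_mpoly (\<lambda>(j, i). v j $ i) f \<noteq> 0}"
      by (rule Collect_cong, rule conj_cong, rule refl, erule eq)
  qed
qed

lemma zariski_open_all: "zariski_open n ({..<n} \<rightarrow>\<^sub>E (proj3 :: ('a::field ^ 4) set set))"
proof -
  let ?one = "Const 1 :: (nat \<times> 4, 'a) mpoly"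
  have one: "eval_mpoly v ?one \<noteq> 0" for v
    by (simp add: eval_mpoly_eq_subst subst_Const[OF rhom_id])
  have "multihomogeneous n (\<lambda>_. 0) ?one"
    by (simp add: multihomogeneous_def Const_def)
  moreover have "{..<n} \<rightarrow>\<^sub>E (proj3 :: ('a ^ 4) set set) = {P \<in> {..<n} \<rightarrow>\<^sub>E proj3.
      \<exists>f\<in>{?one}. \<exists>v. (\<forall>j<n. v j \<in> P j) \<and> eval_mpoly (\<lambda>(j, i). v j $ i) f \<noteq> 0}"
    using reps_exist one by auto
  ultimately show ?thesis
    unfolding zariski_open_def by (intro exI[of _ "{?one}"]) auto
qed

text \<open>Semicontinuity: the general value is the largest one.\<close>

lemma general_alpha_eq_max:
  assumes P: "P \<in> {..<n} \<rightarrow>\<^sub>E (proj3 :: ('a::field_char_0 ^ 4) set set)"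
    and max: "\<And>Q. Q \<in> {..<n} \<rightarrow>\<^sub>E (proj3 :: ('a ^ 4) set set) \<Longrightarrow>
      initial_degree (symbolic_power n Q m) \<le> initial_degree (symbolic_power n P m)"
  shows "general_alpha TYPE('a) n m = initial_degree (symbolic_power n P m)"
proof -
  let ?a = "\<lambda>Q :: nat \<Rightarrow> ('a ^ 4) set. initial_degree (symbolic_power n Q m)"
  have "\<exists>U. zariski_open n U \<and> U \<noteq> {} \<and> (\<forall>Q\<in>U. ?a Q = ?a P)"
  proof (cases "?a P")
    \<comment> \<open>By maximality every tuple then has value 0, so the whole space serves.\<close>
    case 0
    show ?thesis
    proof (intro exI conjI ballI)
      show "zariski_open n ({..<n} \<rightarrow>\<^sub>E (proj3 :: ('a ^ 4) set set))" by (rule zariski_open_all)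
      show "{..<n} \<rightarrow>\<^sub>E (proj3 :: ('a ^ 4) set set) \<noteq> {}" using P by blast
      show "?a Q = ?a P" if "Q \<in> {..<n} \<rightarrow>\<^sub>E proj3" for Q using max[OF that] 0 by simp
    qed
  next
    case (Suc t)
    let ?U = "{Q \<in> {..<n} \<rightarrow>\<^sub>E (proj3 :: ('a ^ 4) set set). \<forall>f\<in>symbolic_power n Q m. is_form t f \<longrightarrow> f = 0}"
    have f0: "f = 0" if "f \<in> symbolic_power n P m" "is_form t f" for f
    proof (rule ccontr)
      assume "f \<noteq> 0"
      from initial_degree_le[OF that(1) this that(2)] Suc show False by simp
    qed
    have PU: "P \<in> ?U" by (intro CollectI conjI P ballI impI) (rule f0)
    have eq: "?a Q = ?a P" if Q: "Q \<in> ?U" for Q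
    proof (rule antisym)
      have QT: "Q \<in> {..<n} \<rightarrow>\<^sub>E proj3" using CollectD[OF Q] by (rule conjunct1)
      have no_form: "\<forall>f\<in>symbolic_power n Q m. is_form t f \<longrightarrow> f = 0" using CollectD[OF Q] by (rule conjunct2)
      show "?a Q \<le> ?a P" by (rule max[OF QT])
      show "?a P \<le> ?a Q"
      proof (rule ccontr)
        assume "\<not> ?thesis"
        then have le: "?a Q \<le> t" using Suc by simp
        obtain f where f: "f \<in> symbolic_power n Q m" "f \<noteq> 0" "is_form (?a Q) f"
          using initial_degree_attained[OF QT] by blast
        \<comment> \<open>A power of x_0 raises a form of smaller degree to degree exactly
          \<open>t\<close>, so excluding the single degree \<open>t\<close> excludes all degrees up
          to \<open>t\<close>.\<close>
        let ?g = "Var 0 ^ (t - ?a Q) * f"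
        have mem: "?g \<in> symbolic_power n Q m" by (rule symbolic_power_scale) fact
        have "is_form ((t - ?a Q) * 1 + ?a Q) ?g"
          by (intro is_form_mult is_form_power is_form_Var f)
        then have "is_form t ?g" using le by simp
        then have "?g = 0" by (rule no_form[THEN bspec, THEN mp, OF mem])
        then show False using f(2) by (simp add: Var_neq_0)
      qed
    qed
    show ?thesis
    proof (intro exI conjI ballI)
      show "zariski_open n ?U" by (rule zariski_open_no_form)
      show "?U \<noteq> {}" using PU by (intro notI) (simp only: empty_iff)
      show "?a Q = ?a P" if "Q \<in> ?U" for Q by (rule eq[OF that])
    qed
  qed
  then obtain U where U: "zariski_open n U" "U \<noteq> {}" "\<And>Q. Q \<in> U \<Longrightarrow> ?a Q = ?a P" by blast
  show ?thesis unfolding general_alpha_def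
  proof (rule the_equality)
    show "\<exists>U. zariski_open n U \<and> U \<noteq> {} \<and> (\<forall>Q\<in>U. ?a Q = ?a P)" using U by blast
  next
    fix a assume "\<exists>W. zariski_open n W \<and> W \<noteq> {} \<and> (\<forall>Q\<in>W. ?a Q = a)"
    then obtain W where W: "zariski_open n W" "W \<noteq> {}" "\<And>Q. Q \<in> W \<Longrightarrow> ?a Q = a" by blast
    \<comment> \<open>The value selected by \<open>THE\<close> is unique because two nonempty open
      sets share a tuple.\<close>
    then obtain Q where "Q \<in> U" "Q \<in> W" using zariski_open_Int_nonempty[OF U(1) W(1) U(2) W(2)] by blast
    then show "a = ?a P" using U(3) W(3) by metis
  qed
qed

lemma general_alpha_max:
  shows general_alpha_attained: "\<exists>P \<in> {..<n} \<rightarrow>\<^sub>E (proj3 :: ('a ^ 4) set set).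
      initial_degree (symbolic_power n P m) = general_alpha TYPE('a::field_char_0) n m"
    and initial_degree_le_general_alpha: "Q \<in> {..<n} \<rightarrow>\<^sub>E (proj3 :: ('a ^ 4) set set) \<Longrightarrow>
      initial_degree (symbolic_power n Q m) \<le> general_alpha TYPE('a) n m"
proof -
  let ?T = "{..<n} \<rightarrow>\<^sub>E (proj3 :: ('a ^ 4) set set)"
  let ?a = "\<lambda>Q. initial_degree (symbolic_power n Q m)"
  have bound: "?a Q \<le> n * m" if "Q \<in> ?T" for Q
    using symbolic_power_nonzero_form[OF that, of m] initial_degree_le by blast
  obtain p :: "('a ^ 4) set" where "p \<in> proj3"
    using ex_proj3[of "vec 1 :: 'a ^ 4"] by (auto simp: vec_eq_iff)
  then have "(\<lambda>j\<in>{..<n}. p) \<in> ?T" by auto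
  moreover have "\<forall>Q. Q \<in> ?T \<longrightarrow> ?a Q < Suc (n * m)" using bound by (simp add: less_Suc_eq_le)
  ultimately have "\<exists>P. P \<in> ?T \<and> (\<forall>Q. Q \<in> ?T \<longrightarrow> ?a Q \<le> ?a P)"
    by (rule ex_has_greatest_nat)
  then obtain P where P: "P \<in> ?T" "\<And>Q. Q \<in> ?T \<Longrightarrow> ?a Q \<le> ?a P" by blast
  have eq: "general_alpha TYPE('a) n m = ?a P"
    by (rule general_alpha_eq_max[OF P(1)]) (rule P(2))
  show "\<exists>P \<in> ?T. ?a P = general_alpha TYPE('a) n m" using P(1) eq by metis
  show "Q \<in> ?T \<Longrightarrow> ?a Q \<le> general_alpha TYPE('a) n m" using P eq by auto
qed

text \<open>At a tuple attaining the value for \<open>a + b\<close>, multiply minimal forms for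
  \<open>a\<close> and for \<open>b\<close>; their degrees there are at most the general ones. Open
  sets for different orders are never intersected.\<close>

lemma general_alpha_subadditive:
  "general_alpha TYPE('a::field_char_0) n (a + b) \<le> general_alpha TYPE('a) n a + general_alpha TYPE('a) n b"
proof -
  obtain P where P: "P \<in> {..<n} \<rightarrow>\<^sub>E (proj3 :: ('a ^ 4) set set)"
    "initial_degree (symbolic_power n P (a + b)) = general_alpha TYPE('a) n (a + b)"
    using general_alpha_attained by blast
  obtain f where f: "f \<in> symbolic_power n P a" "f \<noteq> 0" "is_form (initial_degree (symbolic_power n P a)) f"
    using initial_degree_attained[OF P(1)] by blast
  obtain g where g: "g \<in> symbolic_power n P b" "g \<noteq> 0" "is_form (initial_degree (symbolic_power n P b)) g"
    using initial_degree_attained[OF P(1)] by blast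
  have "initial_degree (symbolic_power n P (a + b)) \<le>
    initial_degree (symbolic_power n P a) + initial_degree (symbolic_power n P b)"
    by (rule initial_degree_le[of "f * g"]) (use f g in \<open>auto intro: symbolic_power_mult is_form_mult\<close>)
  also have "\<dots> \<le> general_alpha TYPE('a) n a + general_alpha TYPE('a) n b"
    by (intro add_mono initial_degree_le_general_alpha P)
  finally show ?thesis using P(2) by simp
qed

lemma general_alpha_ge:
  assumes "k ^ 3 \<le> n"
  shows "k * m \<le> general_alpha TYPE('a::field_char_0) n m"
proof -
  define S :: "'a set" where "S = of_nat ` {..<k}"
  have S: "finite S" "card S = k"
    by (auto simp: S_def card_image inj_on_def)
  let ?E = "PiE (UNIV - {0 :: 4}) (\<lambda>_. S)"
  have E: "finite ?E" "card ?E = k ^ 3"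
    using S by (auto simp: card_PiE card_Diff_singleton intro!: finite_PiE)
  then obtain h where h: "bij_betw h {..<k ^ 3} ?E"
    using ex_bij_betw_nat_finite[of ?E] by (auto simp: atLeast0LessThan)
  \<comment> \<open>For \<open>j\<close> at least \<open>k ^ 3\<close> the value \<open>h j\<close>
    is unspecified, but the zeroth coordinate 1 still makes \<open>v j\<close> represent a
    point.\<close>
  define v where "v = (\<lambda>j. \<chi> i. if i = 0 then 1 else h j i)"
  have v0: "v j \<noteq> 0" for j by (auto simp: v_def vec_eq_iff intro!: exI[of _ 0])
  then have "\<forall>j. \<exists>p. p \<in> proj3 \<and> v j \<in> p" using ex_proj3 by blast
  from choice[OF this] obtain Q where Q: "\<And>j. Q j \<in> proj3" "\<And>j. v j \<in> Q j" by auto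
  define P where "P = restrict Q {..<n}"
  have P: "P \<in> {..<n} \<rightarrow>\<^sub>E proj3" "\<And>j. j < n \<Longrightarrow> v j \<in> P j" using Q by (auto simp: P_def)
  obtain f where f: "f \<in> symbolic_power n P m" "f \<noteq> 0" "is_form (initial_degree (symbolic_power n P m)) f"
    using initial_degree_attained[OF P(1)] by blast
  have van: "vanish m (($) (v j)) f" if "j < n" for j
    using mem_symbolic_power_iff[of n P v _ f m, OF _ _ f(3)] P f(1) that by auto
  have "\<not> initial_degree (symbolic_power n P m) < card S * m"
  proof
    assume "initial_degree (symbolic_power n P m) < card S * m"
    from S(1) f(3) this have "f = 0"
    proof (rule grid_form_eq_0)
      fix x :: "4 \<Rightarrow> 'a" assume x: "x 0 = 1" "\<And>i. i \<noteq> 0 \<Longrightarrow> x i \<in> S"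
      then have "restrict x (UNIV - {0}) \<in> h ` {..<k ^ 3}"
        unfolding bij_betw_imp_surj_on[OF h] by auto
      then obtain j where j: "j < k ^ 3" "h j = restrict x (UNIV - {0})" by auto
      have "($) (v j) = x" using j x by (auto simp: v_def)
      then show "vanish m x f" using van[of j] j assms by simp
    qed
    then show False using f(2) by simp
  qed
  then show ?thesis using initial_degree_le_general_alpha[OF P(1), of m] S by simp
qed

subsection \<open>The Waldschmidt constant\<close>

text \<open>\<open>waldschmidt\<close> is a \<open>lim\<close>, so bounds on the terms reach it only
  once convergence is known. The infimum starts at 1 because the quotient at 0 is 0 by
  convention.\<close>

lemma subadditive_convergent:
  fixes a :: "nat \<Rightarrow> nat"
  assumes sub: "\<And>m n. a (m + n) \<le> a m + a n"
  shows "convergent (\<lambda>n. real (a n) / real n)"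
proof -
  define L where "L = (INF m\<in>{1..}. real (a m) / real m)"
  have bdd: "bdd_below ((\<lambda>m. real (a m) / real m) ` {1..})"
    by (rule bdd_belowI[of _ 0]) auto
  have "(\<lambda>n. real (a n) / real n) \<longlonglongrightarrow> L"
  proof (rule LIMSEQ_I)
    fix \<epsilon> :: real assume "\<epsilon> > 0"
    then have "L < L + \<epsilon> / 2" by simp
    then obtain m where m: "m \<ge> 1" "real (a m) / real m < L + \<epsilon> / 2"
      unfolding L_def by (subst (asm) cINF_less_iff[OF _ bdd]) auto
    \<comment> \<open>Bounds the contribution of the remainder \<open>n mod m\<close>, which becomes
      negligible after division by \<open>n\<close>.\<close>
    define M where "M = Max (a ` {..<m})"
    obtain N where N: "real N > 2 * real M / \<epsilon>" using reals_Archimedean2 by blast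
    have mult: "a (q * m + r) \<le> q * a m + a r" for q r
    proof (induct q)
      case (Suc q)
      have "a (Suc q * m + r) \<le> a m + a (q * m + r)" using sub[of m "q * m + r"] by (simp add: add.assoc)
      with Suc show ?case by simp
    qed simp
    show "\<exists>N. \<forall>n\<ge>N. norm (real (a n) / real n - L) < \<epsilon>"
    proof (intro exI allI impI)
      fix n assume n: "n \<ge> max N 1"
      have "a n \<le> (n div m) * a m + a (n mod m)" using mult[of "n div m" "n mod m"] by simp
      moreover have "a (n mod m) \<le> M" unfolding M_def by (rule Max_ge) (use m in auto)
      ultimately have "real (a n) \<le> real (n div m) * real (a m) + real M"
        by (metis add_left_mono le_trans of_nat_add of_nat_le_iff of_nat_mult)
      also have "real (n div m) * real (a m) \<le> real n * (real (a m) / real m)"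
      proof -
        have "real (n div m) * real m \<le> real n"
          by (metis div_times_less_eq_dividend of_nat_le_iff of_nat_mult)
        then have "real (n div m) \<le> real n / real m" using m(1) by (simp add: le_divide_eq)
        from mult_right_mono[OF this, of "real (a m)"] show ?thesis by simp
      qed
      finally have "real (a n) / real n \<le> (real n * (real (a m) / real m) + real M) / real n"
        by (simp add: divide_right_mono)
      also have "\<dots> = real (a m) / real m + real M / real n"
        using n by (simp add: add_divide_distrib)
      also have "real M / real n < \<epsilon> / 2"
      proof -
        have "2 * real M / \<epsilon> < real n" using N n by linarith
        then have "2 * real M < \<epsilon> * real n" using \<open>\<epsilon> > 0\<close> by (simp add: field_simps)
        then show ?thesis using n by (simp add: field_simps)
      qed
      finally have "real (a n) / real n < L + \<epsilon>" using m(2) by linarith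
      moreover have "L \<le> real (a n) / real n"
        unfolding L_def by (rule cINF_lower[OF bdd]) (use n in auto)
      ultimately show "norm (real (a n) / real n - L) < \<epsilon>" by simp
    qed
  qed
  then show ?thesis by (rule convergentI)
qed

lemma waldschmidt_ge:
  assumes "k ^ 3 \<le> n"
  shows "real k \<le> waldschmidt TYPE('a::field_char_0) n"
proof -
  let ?w = "\<lambda>m. real (general_alpha TYPE('a) n m) / real m"
  have "?w \<longlonglongrightarrow> waldschmidt TYPE('a) n"
    unfolding waldschmidt_def convergent_LIMSEQ_iff[symmetric]
    by (rule subadditive_convergent) (rule general_alpha_subadditive)
  moreover have "real k \<le> ?w m" if "m \<ge> 1" for m
  proof -
    have "real k * real m \<le> real (general_alpha TYPE('a) n m)"
      using general_alpha_ge[OF assms, of m, where 'a = 'a] by (metis of_nat_le_iff of_nat_mult)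
    then show ?thesis using that by (simp add: le_divide_eq)
  qed
  ultimately show ?thesis by (intro LIMSEQ_le_const) blast+
qed

section \<open>Numerical comparison of \<open>delta n\<close> with the integer part of the cube
  root\<close>

theorem proposition12:
  fixes n :: nat
  assumes "n \<ge> 512"
  shows "waldschmidt TYPE('a::field_char_0) n \<ge> delta n \<and>
         delta n \<ge> 0.7787 * root 3 (real n) + 0.6142"
proof -
  define x where "x = root 3 (real n)"
  define k where "k = nat \<lfloor>x\<rfloor>"
  have x3: "x ^ 3 = real n" by (simp add: x_def)
  have "root 3 (8 ^ 3) \<le> x"
    unfolding x_def using assms by (intro real_root_le_mono) auto
  then have x8: "8 \<le> x" using real_root_power_cancel[of 3 8] by simp
  have k: "real k \<le> x" "x < real k + 1" "8 \<le> real k"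
    using x8 by (auto simp: k_def)
  have "real (k ^ 3) \<le> real n"
    using power_mono[OF k(1), of 3] x3 by simp
  then have "k ^ 3 \<le> n" by (simp only: of_nat_le_iff)
  then have w: "real k \<le> waldschmidt TYPE('a) n" by (rule waldschmidt_ge)
  \<comment> \<open>The constants 1.817 and 1.8172 enclose \<open>root 3 6\<close>: their cubes are
    about 5.9988 and 6.0008.\<close>
  have "root 3 6 \<le> root 3 (1.8172 ^ 3)" by (intro real_root_le_mono) (simp_all add: power3_eq_cube)
  also have "\<dots> = 1.8172" by (rule real_root_power_cancel) simp_all
  finally have up: "root 3 6 \<le> 1.8172" .
  have "1.817 = root 3 (1.817 ^ 3)" by (rule real_root_power_cancel[symmetric]) simp_all
  also have "\<dots> \<le> root 3 6" by (intro real_root_le_mono) (simp_all add: power3_eq_cube)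
  finally have lo: "1.817 \<le> root 3 6" .
  define y where "y = root 3 6 * x"
  have d: "delta n = (3 * y + 4.3) / 7"
    by (simp add: delta_def x_def y_def real_root_mult)
  have "y \<le> 1.8172 * x" "1.817 * x \<le> y"
    unfolding y_def using up lo x8 by (auto intro!: mult_right_mono)
  \<comment> \<open>With x < k + 1 the first inequality reduces to 9.7516 \<le> 1.5484 k, for which
    8 \<le> k suffices. For the second, 3 * 1.817 / 7 > 0.7787 and 4.3 / 7 > 0.6142.\<close>
  then have "delta n \<le> real k \<and> 0.7787 * x + 0.6142 \<le> delta n"
    unfolding d using k by simp
  then show ?thesis using w by (simp add: x_def)
qed

end
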